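(* There exists a universal constant $c>0$ such that for every $\beta\in[0,\infty)$ there exist a candidate-ability distribution $F\in\mathscr{F}_{\beta,1/2}$ (that is, a $(\beta,\varepsilon_0,\delta)$-clustered distribution with $\varepsilon_0=1/2$ and $\delta=0$) and a time horizon $T_0<\infty$ such that, for the multisecretary problem with ability distribution $F$, for all $T\ge T_0$ and for any online policy $\pi$ (i.e. any choice of $\pi\in\Pi(B,T)$ for each budget $B$), $$\sup_{B\in[T]}\mathrm{Regret}(B,T;\pi)\ \ge\ \frac{c}{1+\beta}\,T^{\frac12-\frac{1}{2(\beta+1)}}\,\mathbf 1\{\beta>0\}+c\,\log T\,\mathbf 1\{\beta=0\}.$$
   Context: Multisecretary problem: a horizon $T\in\mathbb N$ and a hiring budget $B\in[T]=\{1,\dots,T\}$ are given. Abilities $\theta_1,\dots,\theta_T\in[0,1]$ are i.i.d. from a known distribution with CDF $F$. At each time $t$, after observing $\theta_t$, the decision maker irrevocably accepts ($a_t=1$) or rejects ($a_t=0$) candidate $t$; at most $B$ candidates may be accepted. Let $U_1,\dots,U_T$ be i.i.d. uniform on $[0,1]$, independent of the abilities, and $\mathcal F_t=\sigma(\theta_1,U_1,\dots,\theta_t,U_t)$. A (feasible, online, possibly randomized) policy $\pi\in\Pi(B,T)$ is a sequence $(a_t^\pi)_{t\le T}$ of $\{0,1\}$-valued random variables with $a_t^\pi$ $\mathcal F_t$-measurable and $\sum_t a_t^\pi\le B$ almost surely. The hindsight value is $V^{\mathrm{hs}}_1(B,T)=\mathbb E\big[\max\{\sum_t\theta_t a_t: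 a\in\{0,1\}^T,\ \sum_t a_t\le B\}\big]$, and $\mathrm{Regret}(B,T;\pi)=V^{\mathrm{hs}}_1(B,T)-\mathbb E[\sum_t\theta_t a_t^\pi]$. Clustered distributions: let $F^{-1}(q)=\inf\{v:F(v)\ge q\}$. For $\beta\in[0,\infty)$, $\varepsilon_0\in(0,1]$, $\delta\in[0,1]$, $F$ is $(\beta,\varepsilon_0,\delta)$-clustered if there exist $n\in\mathbb N\cup\{0\}$ and gap quantiles $q_0^\star=0<q_1^\star<\dots<q_n^\star<q_{n+1}^\star=1$ such that (a) for all $i\in\{1,\dots,n+1\}$ and all $q,\tilde q\in(q_{i-1}^\star,q_i^\star]$, $|F^{-1}(q)-F^{-1}(\tilde q)|\le C_0|q-\tilde q|^{1/(\beta+1)}+\delta$ for some constant $C_0<\infty$; and (b) $q_i^\star-q_{i-1}^\star\ge\varepsilon_0$ for all $i\in\{1,\dots,n+1\}$. $\mathscr F_{\beta,\varepsilon_0}$ is the class of $(\beta,\varepsilon_0,0)$-clustered distributions. *)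

theory Defs
  imports "HOL-Probability.Probability"
begin

text \<open>Distributions are Borel probability measures on the reals; the CDF is \<open>cdf F\<close>.\<close>

definition ability_distribution :: "real measure \<Rightarrow> bool" where
  "ability_distribution F \<longleftrightarrow> real_distribution F \<and> measure F {0..1} = 1"

definition quantile :: "real measure \<Rightarrow> real \<Rightarrow> real" where
  "quantile F q = Inf {v. cdf F v \<ge> q}"

definition clustered :: "real \<Rightarrow> real \<Rightarrow> real \<Rightarrow> real measure \<Rightarrow> bool" where
  "clustered \<beta> \<epsilon>\<^sub>0 \<delta> F \<longleftrightarrow>
     \<beta> \<ge> 0 \<and> 0 < \<epsilon>\<^sub>0 \<and> \<epsilon>\<^sub>0 \<le> 1 \<and> 0 \<le> \<delta> \<and> \<delta> \<le> 1 \<and> ability_distribution F \<and>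
     (\<exists>(n::nat) (qs::nat \<Rightarrow> real) (C\<^sub>0::real).
        qs 0 = 0 \<and> qs (n + 1) = 1 \<and> (\<forall>i\<in>{1..n+1}. qs (i - 1) < qs i) \<and>
        (\<forall>i\<in>{1..n+1}. \<forall>q\<in>{qs (i - 1)<..qs i}. \<forall>q'\<in>{qs (i - 1)<..qs i}.
            \<bar>quantile F q - quantile F q'\<bar> \<le> C\<^sub>0 * \<bar>q - q'\<bar> powr (1 / (\<beta> + 1)) + \<delta>) \<and>
        (\<forall>i\<in>{1..n+1}. qs i - qs (i - 1) \<ge> \<epsilon>\<^sub>0))"

definition clustered_class :: "real \<Rightarrow> real \<Rightarrow> real measure set" where
  "clustered_class \<beta> \<epsilon>\<^sub>0 = {F. clustered \<beta> \<epsilon>\<^sub>0 0 F}"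

text \<open>
  The abilities and the randomization variables are the coordinates of the canonical
  product space: a scenario \<open>\<omega>\<close> assigns to each time \<open>t \<in> {1..T}\<close> the pair
  \<open>(\<theta>\<^sub>t, U\<^sub>t)\<close>, and all coordinates are independent.
\<close>

type_synonym scenario = "nat \<Rightarrow> real \<times> real"

definition scenarios :: "real measure \<Rightarrow> nat \<Rightarrow> scenario measure" where
  "scenarios F T = PiM {1..T} (\<lambda>_. F \<Otimes>\<^sub>M uniform_measure lborel {0..1})"

definition ability :: "nat \<Rightarrow> scenario \<Rightarrow> real" where
  "ability t \<omega> = fst (\<omega> t)"

definition seed :: "nat \<Rightarrow> scenario \<Rightarrow> real" where
  "seed t \<omega> = snd (\<omega> t)"

text \<open>The sigma-algebra generated by \<open>\<theta>\<^sub>1, U\<^sub>1, \<dots>, \<theta>\<^sub>t, U\<^sub>t\<close>.\<close>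

definition history :: "real measure \<Rightarrow> nat \<Rightarrow> nat \<Rightarrow> scenario measure" where
  "history F T t = sigma (space (scenarios F T))
     (\<Union>s\<in>{1..t}. {ability s -` A \<inter> space (scenarios F T) | A. A \<in> sets borel} \<union>
                 {seed s -` A \<inter> space (scenarios F T) | A. A \<in> sets borel})"

definition policies :: "real measure \<Rightarrow> nat \<Rightarrow> nat \<Rightarrow> (nat \<Rightarrow> scenario \<Rightarrow> nat) set" where
  "policies F B T = {a.
     (\<forall>t\<in>{1..T}. a t \<in> history F T t \<rightarrow>\<^sub>M count_space {0, 1}) \<and>
     (AE \<omega> in scenarios F T. (\<Sum>t=1..T. a t \<omega>) \<le> B)}"

definition hindsight_value :: "real measure \<Rightarrow> nat \<Rightarrow> nat \<Rightarrow> real" where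
  "hindsight_value F B T =
     (\<integral>\<omega>. Max {\<Sum>t=1..T. ability t \<omega> * real (a t) | a.
              a \<in> {1..T} \<rightarrow>\<^sub>E {0, 1::nat} \<and> (\<Sum>t=1..T. a t) \<le> B} \<partial>scenarios F T)"

definition regret :: "real measure \<Rightarrow> nat \<Rightarrow> nat \<Rightarrow> (nat \<Rightarrow> scenario \<Rightarrow> nat) \<Rightarrow> real" where
  "regret F B T a =
     hindsight_value F B T - (\<integral>\<omega>. (\<Sum>t=1..T. ability t \<omega> * real (a t \<omega>)) \<partial>scenarios F T)"

end

theory Submission
  imports Defs
begin

text \<open>
  In both regimes the budget is \<open>B = T div 2\<close>, and the reward of an arbitrary policy is controlled
  through prices: if \<open>p\<close> is a price per hire, a decision at time \<open>t\<close> should be judged by the sign of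
  \<open>\<theta>\<^sub>t - p\<close>, and a wrong decision costs \<open>\<bar>\<theta>\<^sub>t - p\<bar>\<close>. The policy sees \<open>\<theta>\<^sub>t\<close> but not the
  hindsight price, which depends on the future.

  \<^bold>\<open>The case \<open>\<beta> > 0\<close>.\<close> Put \<open>\<alpha> = 1 / (\<beta> + 1)\<close> and let the abilities have quantile function
  \<open>q \<mapsto> (max 0 (2q - 1))\<^sup>\<alpha>\<close>. This is \<open>\<alpha>\<close>-Hoelder, and steep at the median, exactly where the budget
  \<open>T/2\<close> puts the hindsight price. Among \<open>T\<close> candidates the number above a fixed quantile fluctuates
  by order \<open>\<surd>T\<close>. So, if the first \<open>T/400\<close> periods have run typically, then with constant probability
  the future is poor, at most \<open>B\<close> candidates have positive ability and no positive candidate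
  should be rejected, and with constant probability it is rich, at least \<open>B\<close> candidates lie above the
  quantile \<open>1/2 + 3\<epsilon>\<close> with \<open>\<epsilon> \<approx> 1/\<surd>T\<close> and no candidate below that level should be accepted. An early
  candidate whose quantile lies in \<open>[1/2 + \<epsilon>, 1/2 + 2\<epsilon>]\<close>, an event of probability \<open>\<epsilon>\<close>, is therefore
  costly either way: rejecting and accepting both lose at least order \<open>\<alpha> \<epsilon>\<^sup>\<alpha>\<close> with constant probability, since
  the decision is independent of the future. Summing over \<open>T/400\<close> periods gives
  \<open>\<alpha> T \<epsilon> powr (1 + \<alpha>) \<approx> \<alpha> T powr (1/2 - \<alpha>/2)\<close>; this is \<open>hinge_regret\<close>. The pathwise costs are
  \<open>gap_when_positive_fit\<close> and \<open>gap_when_level_full\<close>, and the fluctuations come from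
  \<open>binomial_anticoncentration\<close>.

  \<^bold>\<open>The case \<open>\<beta> = 0\<close>.\<close> Here the abilities are uniform. The argument above only sees the scale \<open>\<surd>T\<close>
  and would give a constant; the logarithm comes from all time scales, because near the end the
  remaining budget must be met exactly. It is captured by duality: for every adapted martingale
  \<open>p\<^sub>0, \<dots>, p\<^sub>T\<close> the policy cannot collect more than
  \<open>\<Sum>\<^sub>t E (\<theta>\<^sub>t - p\<^sub>t)\<^sup>+ + B E p\<^sub>T\<^sup>+\<close>, since \<open>E (p\<^sub>t a\<^sub>t) = E (p\<^sub>T a\<^sub>t)\<close> and \<open>\<Sum>\<^sub>t a\<^sub>t \<le> B\<close>. The martingale
  starts at \<open>1/2\<close> and moves up after a candidate above \<open>1/2\<close> and down otherwise, by an amount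
  proportional to \<open>1/s\<close> when \<open>s\<close> periods remain. Its positive correlation with \<open>\<theta>\<^sub>t\<close> saves \<open>1/(8s)\<close>
  at that step, whereas its variance, of order \<open>1/s\<close>, costs only half of that. Hence the bound is
  smaller than the fluid value \<open>3T/8\<close> by a multiple of \<open>\<Sum> 1/s\<close>, that is, of \<open>ln T\<close>
  (\<open>reward_le\<close>, \<open>total_step_value_le\<close>), while the hindsight value is within a constant of \<open>3T/8\<close>
  (\<open>expectation_best_ge\<close>). Together this is \<open>uniform_regret\<close>.
\<close>

section \<open>Scenarios and independence of past and future\<close>

locale multisecretary =
  fixes F :: "real measure" and T :: nat
  assumes ability_distribution: "ability_distribution F"
begin

abbreviation P :: "scenario measure" where "P \<equiv> scenarios F T"

abbreviation candidate :: "(real \<times> real) measure" where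
  "candidate \<equiv> F \<Otimes>\<^sub>M uniform_measure lborel {0..1}"

lemma prob_space_F: "prob_space F" and sets_F [measurable_cong, simp]: "sets F = sets borel"
  and space_F [simp]: "space F = UNIV"
proof -
  interpret real_distribution F using ability_distribution by (simp add: ability_distribution_def)
  show "prob_space F" "sets F = sets borel" "space F = UNIV" by (unfold_locales) auto
qed

lemma prob_space_candidate: "prob_space candidate"
proof -
  interpret F: prob_space F by (rule prob_space_F)
  interpret U: prob_space "uniform_measure lborel {0..1::real}"
    by (rule prob_space_uniform_measure) auto
  interpret pair_prob_space F "uniform_measure lborel {0..1::real}" ..
  show ?thesis by unfold_locales
qed

sublocale prob_space P
  unfolding scenarios_def by (intro prob_space_PiM prob_space_candidate)

lemma measurable_coordinate: "t \<in> {1..T} \<Longrightarrow> (\<lambda>\<omega>. \<omega> t) \<in> P \<rightarrow>\<^sub>M candidate"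
  unfolding scenarios_def by simp

lemma measurable_ability [measurable]: "t \<in> {1..T} \<Longrightarrow> ability t \<in> borel_measurable P"
  unfolding ability_def using measurable_compose[OF measurable_coordinate[of t] measurable_fst]
  by (simp cong: measurable_cong_sets)

lemma measurable_seed: "t \<in> {1..T} \<Longrightarrow> seed t \<in> borel_measurable P"
  unfolding seed_def using measurable_compose[OF measurable_coordinate[of t] measurable_snd]
  by (simp cong: measurable_cong_sets)

lemma distr_ability: assumes "t \<in> {1..T}" shows "distr P borel (ability t) = F"
proof -
  interpret F: prob_space F by (rule prob_space_F)
  interpret U: prob_space "uniform_measure lborel {0..1::real}"
    by (rule prob_space_uniform_measure) auto
  have "distr P borel (ability t) = distr (distr P candidate (\<lambda>\<omega>. \<omega> t)) F fst"
    using assms measurable_coordinate[OF assms]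
    by (subst distr_distr) (auto simp: ability_def comp_def intro!: distr_cong)
  also have "distr P candidate (\<lambda>\<omega>. \<omega> t) = candidate"
    unfolding scenarios_def using assms prob_space_candidate by (intro distr_PiM_component) auto
  also have "distr candidate F fst = F" by (rule U.distr_pair_fst)
  finally show ?thesis .
qed

lemma AE_ability: "AE \<omega> in P. \<forall>t\<in>{1..T}. ability t \<omega> \<in> {0..1}"
proof -
  interpret F: prob_space F by (rule prob_space_F)
  have "AE x in F. x \<in> {0..1::real}"
    using ability_distribution by (intro F.AE_prob_1) (auto simp: ability_distribution_def)
  hence "AE \<omega> in P. ability t \<omega> \<in> {0..1}" if "t \<in> {1..T}" for t
    using that by (subst (asm) distr_ability[OF that, symmetric])
       (auto simp: AE_distr_iff intro: measurable_ability)
  thus ?thesis by (simp add: AE_finite_all)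
qed

lemma space_history [simp]: "space (history F T t) = space P"
  unfolding history_def by (subst space_measure_of) auto

abbreviation generators where
  "generators t \<equiv> (\<Union>s\<in>{1..t}. {ability s -` A \<inter> space P | A. A \<in> sets borel} \<union>
                 {seed s -` A \<inter> space P | A. A \<in> sets borel})"

lemma sets_history: "sets (history F T t) = sigma_sets (space P) (generators t)"
  unfolding history_def by (subst sets_measure_of) auto

lemma history_mono: "s \<le> t \<Longrightarrow> X \<in> history F T s \<rightarrow>\<^sub>M N \<Longrightarrow> X \<in> history F T t \<rightarrow>\<^sub>M N"
proof (erule measurable_mono[THEN subsetD, rotated -1])
  assume "s \<le> t"
  thus "sets (history F T s) \<subseteq> sets (history F T t)"
    unfolding sets_history by (intro sigma_sets_mono' UN_mono) auto
qed auto

lemma measurable_history: "t \<le> T \<Longrightarrow> X \<in> history F T t \<rightarrow>\<^sub>M N \<Longrightarrow> X \<in> P \<rightarrow>\<^sub>M N"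
proof (erule measurable_mono[THEN subsetD, rotated -1])
  assume "t \<le> T"
  thus "sets (history F T t) \<subseteq> sets P"
    unfolding sets_history
    by (intro sets.sigma_sets_subset) (auto intro!: measurable_sets measurable_ability measurable_seed)
qed auto

lemma ability_history: "s \<in> {1..t} \<Longrightarrow> ability s \<in> borel_measurable (history F T t)"
proof -
  assume s: "s \<in> {1..t}"
  have "ability s -` A \<inter> space P \<in> sigma_sets (space P) (generators t)" if "A \<in> sets borel" for A
    using s that by (intro sigma_sets.Basic UN_I[of s]) auto
  thus ?thesis unfolding measurable_def sets_history by simp
qed

lemma indep_vars_coordinates: "indep_vars (\<lambda>_. candidate) (\<lambda>t \<omega>. \<omega> t) {1..T}"
proof (cases "T = 0")
  case True
  thus ?thesis unfolding indep_vars_def indep_sets_def by auto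
next
  case False
  have "distr P (PiM {1..T} (\<lambda>_. candidate)) (\<lambda>\<omega>. \<lambda>t\<in>{1..T}. \<omega> t) = P"
    unfolding scenarios_def
    by (rule trans[OF distr_cong distr_id]) (auto simp: space_PiM PiE_restrict)
  moreover have "distr P candidate (\<lambda>\<omega>. \<omega> t) = candidate" if "t \<in> {1..T}" for t
    unfolding scenarios_def using that prob_space_candidate by (intro distr_PiM_component) auto
  ultimately show ?thesis using False
    by (subst indep_vars_iff_distr_eq_PiM')
       (auto simp: measurable_coordinate scenarios_def[symmetric] scenarios_def[of F T] intro!: PiM_cong)
qed

lemma indep_vars_abilities: "indep_vars (\<lambda>_. borel) ability {1..T}"
  unfolding ability_def
  by (rule indep_vars_compose2[OF indep_vars_coordinates]) simp

text \<open>
  The past is generated by the coordinates up to \<open>t\<close> and the future abilities are a function of the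
  coordinates after \<open>t\<close>, so independence is inherited from the product measure. The point of the lemma is
  that it applies to everything measurable in the history, in particular to the decision \<open>a\<^sub>t\<close>, which may
  use the randomization seeds.
\<close>
lemma indep_history_future:
  fixes X :: "scenario \<Rightarrow> real"
  assumes X: "X \<in> borel_measurable (history F T t)" and t: "t \<le> T"
    and g: "g \<in> borel_measurable (PiM {t<..T} (\<lambda>_. borel))"
  shows "indep_var borel X borel (\<lambda>\<omega>. g (\<lambda>s\<in>{t<..T}. ability s \<omega>))"
proof -
  let ?R = "\<lambda>\<omega>. restrict (\<lambda>s. \<omega> s) {1..t}" and ?Y = "\<lambda>\<omega>. g (\<lambda>s\<in>{t<..T}. ability s \<omega>)"
  let ?Q = "\<lambda>\<omega>. restrict (\<lambda>s. \<omega> s) {t<..T}"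
  let ?\<R> = "sigma_sets (space P) {?R -` A \<inter> space P |A. A \<in> sets (PiM {1..t} (\<lambda>_. candidate))}"
  let ?\<Q> = "sigma_sets (space P) {?Q -` A \<inter> space P |A. A \<in> sets (PiM {t<..T} (\<lambda>_. candidate))}"
  have I: "indep_var (PiM {1..t} (\<lambda>_. candidate)) ?R (PiM {t<..T} (\<lambda>_. candidate)) ?Q"
    using t by (intro indep_var_restrict[OF indep_vars_coordinates]) auto
  have "(\<lambda>f. \<lambda>s\<in>{t<..T}. fst (f s)) \<in> PiM {t<..T} (\<lambda>_. candidate) \<rightarrow>\<^sub>M PiM {t<..T} (\<lambda>_. borel)"
    by (auto intro!: measurable_restrict)
  from measurable_compose[OF this g]
  have g': "(\<lambda>f. g (\<lambda>s\<in>{t<..T}. fst (f s))) \<in> borel_measurable (PiM {t<..T} (\<lambda>_. candidate))" .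
  have "indep_var borel (\<lambda>_. 0::real) borel ((\<lambda>f. g (\<lambda>s\<in>{t<..T}. fst (f s))) \<circ> ?Q)"
    using indep_var_compose[OF I, of "\<lambda>_. 0::real" borel, OF _ g'] by (simp add: comp_def)
  moreover have eqY: "(\<lambda>f. g (\<lambda>s\<in>{t<..T}. fst (f s))) \<circ> ?Q = ?Y"
    by (auto simp: fun_eq_iff ability_def intro!: arg_cong[of _ _ g])
  ultimately have Y: "?Y \<in> borel_measurable P" by (auto simp: indep_var_rv2)
  have Q: "sigma_sets (space P) {?Y -` A \<inter> space P |A. A \<in> sets borel} \<subseteq> ?\<Q>"
  proof (intro sigma_sets_mono subsetI)
    fix h assume "h \<in> {?Y -` A \<inter> space P |A. A \<in> sets borel}"
    then obtain A where A: "A \<in> sets borel" and h: "h = ?Y -` A \<inter> space P" by auto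
    have "?Q \<in> P \<rightarrow>\<^sub>M PiM {t<..T} (\<lambda>_. candidate)" using I by (rule indep_var_rv2)
    from measurable_space[OF this]
    have "h = ?Q -` ((\<lambda>f. g (\<lambda>s\<in>{t<..T}. fst (f s))) -` A \<inter> space (PiM {t<..T} (\<lambda>_. candidate))) \<inter> space P"
      unfolding h eqY[symmetric] by auto
    thus "h \<in> ?\<Q>" using measurable_sets[OF g' A] by (intro sigma_sets.Basic) blast
  qed
  have R: "?R \<omega> \<in> space (PiM {1..t} (\<lambda>_. candidate))" if "\<omega> \<in> space P" for \<omega>
    using measurable_space[OF indep_var_rv1[OF I] that] .
  have gen: "g \<in> ?\<R>" if "g \<in> generators t" for g
  proof -
    from that obtain s A where s: "s \<in> {1..t}" and A: "A \<in> sets borel"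
      and g: "g = ability s -` A \<inter> space P \<or> g = seed s -` A \<inter> space P" by auto
    have "(\<lambda>f. fst (f s)) \<in> PiM {1..t} (\<lambda>_. candidate) \<rightarrow>\<^sub>M borel"
      "(\<lambda>f. snd (f s)) \<in> PiM {1..t} (\<lambda>_. candidate) \<rightarrow>\<^sub>M borel"
      using s by measurable
    hence "(\<lambda>f. fst (f s)) -` A \<inter> space (PiM {1..t} (\<lambda>_. candidate)) \<in> sets (PiM {1..t} (\<lambda>_. candidate))"
      "(\<lambda>f. snd (f s)) -` A \<inter> space (PiM {1..t} (\<lambda>_. candidate)) \<in> sets (PiM {1..t} (\<lambda>_. candidate))"
      using A by (auto intro: measurable_sets)
    moreover have "ability s -` A \<inter> space P
        = ?R -` ((\<lambda>f. fst (f s)) -` A \<inter> space (PiM {1..t} (\<lambda>_. candidate))) \<inter> space P"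
      "seed s -` A \<inter> space P
        = ?R -` ((\<lambda>f. snd (f s)) -` A \<inter> space (PiM {1..t} (\<lambda>_. candidate))) \<inter> space P"
      using s R by (auto simp: ability_def seed_def)
    ultimately show ?thesis using g by (intro sigma_sets.Basic) blast
  qed
  have "sigma_sets (space P) {X -` A \<inter> space P |A. A \<in> sets borel} \<subseteq> ?\<R>"
  proof (intro sigma_sets_mono subsetI)
    fix g assume "g \<in> {X -` A \<inter> space P |A. A \<in> sets borel}"
    hence "g \<in> sigma_sets (space P) (generators t)"
      using measurable_sets[OF X] by (auto simp: sets_history)
    moreover have "sigma_sets (space P) (generators t) \<subseteq> ?\<R>"
      by (intro sigma_sets_mono subsetI gen)
    ultimately show "g \<in> ?\<R>" by blast
  qed
  thus ?thesis using I Q Y measurable_history[OF t X]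
    unfolding indep_var_eq indep_sets2_eq by blast
qed

lemma indep_history_ability:
  fixes X :: "scenario \<Rightarrow> real"
  assumes X: "X \<in> borel_measurable (history F T t)" and r: "r \<in> {t<..T}"
  shows "indep_var borel X borel (ability r)"
proof -
  have t: "t \<le> T" using r by auto
  have "indep_var borel X borel (\<lambda>\<omega>. (\<lambda>f. f r) (\<lambda>s\<in>{t<..T}. ability s \<omega>))"
    using r by (intro indep_history_future[OF X t]) auto
  thus ?thesis using r by simp
qed

text \<open>
  Fubini in the form in which conditional expectations are used below: given the past, a later ability is
  a fresh sample of \<open>F\<close>.
\<close>
lemma integral_history_ability:
  fixes f :: "real \<times> real \<Rightarrow> real"
  assumes X: "X \<in> borel_measurable (history F T t)" and r: "r \<in> {t<..T}"
    and f [measurable]: "f \<in> borel_measurable borel" and int: "integrable P (\<lambda>\<omega>. f (X \<omega>, ability r \<omega>))"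
  shows "(\<integral>\<omega>. f (X \<omega>, ability r \<omega>) \<partial>P) = (\<integral>\<omega>. (\<integral>y. f (X \<omega>, y) \<partial>F) \<partial>P)"
    and "integrable P (\<lambda>\<omega>. \<integral>y. f (X \<omega>, y) \<partial>F)"
proof -
  have [measurable]: "X \<in> borel_measurable P" "ability r \<in> borel_measurable P"
    using r X by (auto intro: measurable_history[of t])
  interpret F: prob_space F by (rule prob_space_F)
  interpret X: prob_space "distr P borel X" by (rule prob_space_distr) simp
  interpret XF: pair_prob_space "distr P borel X" F ..
  have D: "distr P borel (\<lambda>\<omega>. (X \<omega>, ability r \<omega>)) = distr P borel X \<Otimes>\<^sub>M F"
    using indep_history_ability[OF X r] r distr_ability[of r]
    by (auto simp: indep_var_distribution_eq borel_prod)
  have m: "(\<lambda>\<omega>. (X \<omega>, ability r \<omega>)) \<in> P \<rightarrow>\<^sub>M borel"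
    unfolding borel_prod[symmetric] by measurable
  have I: "integrable (distr P borel X \<Otimes>\<^sub>M F) f"
    using int by (subst D[symmetric], subst integrable_distr_eq[OF m]) auto
  have "(\<integral>\<omega>. f (X \<omega>, ability r \<omega>) \<partial>P) = integral\<^sup>L (distr P borel X \<Otimes>\<^sub>M F) f"
    by (subst D[symmetric], subst integral_distr[OF m]) auto
  also have "\<dots> = (\<integral>x. \<integral>y. f (x, y) \<partial>F \<partial>distr P borel X)"
    using I by (simp add: XF.integral_fst')
  also have "\<dots> = (\<integral>\<omega>. (\<integral>y. f (X \<omega>, y) \<partial>F) \<partial>P)"
  proof (rule integral_distr)
    have "f \<in> borel_measurable (borel \<Otimes>\<^sub>M F)" using f unfolding borel_prod[symmetric] by (simp cong: measurable_cong_sets sets_pair_measure_cong)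
    thus "(\<lambda>x. \<integral>y. f (x, y) \<partial>F) \<in> borel_measurable borel" 
      by (intro F.borel_measurable_lebesgue_integral) simp
  qed simp
  finally show "(\<integral>\<omega>. f (X \<omega>, ability r \<omega>) \<partial>P) = (\<integral>\<omega>. (\<integral>y. f (X \<omega>, y) \<partial>F) \<partial>P)" .
  have "integrable (distr P borel X) (\<lambda>x. \<integral>y. f (x, y) \<partial>F)"
    using I by (rule XF.integrable_fst')
  thus "integrable P (\<lambda>\<omega>. \<integral>y. f (X \<omega>, y) \<partial>F)"
    by (rule integrable_distr[rotated]) simp
qed

end

section \<open>The hindsight optimum, pathwise regret and tallies\<close>

context multisecretary begin

definition best :: "nat \<Rightarrow> scenario \<Rightarrow> real" where
  "best B \<omega> = Max {\<Sum>t=1..T. ability t \<omega> * real (a t) | a.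
              a \<in> {1..T} \<rightarrow>\<^sub>E {0, 1::nat} \<and> (\<Sum>t=1..T. a t) \<le> B}"

abbreviation budget_choices :: "nat \<Rightarrow> (nat \<Rightarrow> nat) set" where
  "budget_choices B \<equiv> {a \<in> {1..T} \<rightarrow>\<^sub>E {0, 1::nat}. (\<Sum>t=1..T. a t) \<le> B}"

lemma best_eq: "best B \<omega> = Max ((\<lambda>a. \<Sum>t=1..T. ability t \<omega> * real (a t)) ` budget_choices B)"
  unfolding best_def by (rule arg_cong[of _ _ Max]) auto

lemma finite_budget_choices: "finite (budget_choices B)"
  by (rule finite_subset[of _ "{1..T} \<rightarrow>\<^sub>E {0, 1::nat}"]) (auto intro: finite_PiE)

lemma best_ge:
  assumes "S \<subseteq> {1..T}" "card S \<le> B"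
  shows "(\<Sum>t\<in>S. ability t \<omega>) \<le> best B \<omega>"
proof -
  let ?a = "\<lambda>t\<in>{1..T}. if t \<in> S then 1 else 0 :: nat"
  have fin: "finite S" using assms(1) by (rule finite_subset) simp
  have "(\<Sum>t=1..T. ?a t) = (\<Sum>t\<in>{1..T}. if t \<in> S then 1 else 0)" by (intro sum.cong) auto
  also have "\<dots> = card S" using assms(1) by (simp add: sum.If_cases Int_absorb1)
  finally have "?a \<in> budget_choices B" using assms(2) by auto
  moreover have "(\<Sum>t\<in>S. ability t \<omega>) = (\<Sum>t=1..T. ability t \<omega> * real (?a t))"
    using assms(1) by (intro sum.mono_neutral_cong_left) auto
  ultimately have "(\<Sum>t\<in>S. ability t \<omega>)
      \<in> (\<lambda>a. \<Sum>t=1..T. ability t \<omega> * real (a t)) ` budget_choices B"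
    by (intro image_eqI[of _ _ ?a])
  thus ?thesis unfolding best_eq by (rule Max_ge[OF finite_imageI[OF finite_budget_choices]])
qed

lemma best_measurable [measurable]: "best B \<in> borel_measurable P"
  unfolding best_eq
  by (intro borel_measurable_Max finite_budget_choices borel_measurable_sum
      borel_measurable_times measurable_ability) auto

lemma best_le:
  assumes "\<forall>t\<in>{1..T}. ability t \<omega> \<in> {0..1}"
  shows "best B \<omega> \<le> real T"
proof -
  have "(\<Sum>t=1..T. ability t \<omega> * real (a t)) \<le> real T" if a: "a \<in> budget_choices B" for a
  proof -
    have "ability t \<omega> * real (a t) \<le> 1" if "t \<in> {1..T}" for t
    proof -
      have "a t \<in> {0,1}" using a that by (auto dest!: PiE_mem)
      thus ?thesis using assms that by auto
    qed
    from sum_bounded_above[of "{1..T}", OF this] show ?thesis by simp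
  qed
  moreover have "budget_choices B \<noteq> {}"
    by (rule ex_in_conv[THEN iffD1], rule exI[of _ "\<lambda>t\<in>{1..T}. 0"]) auto
  ultimately show ?thesis unfolding best_eq
    by (subst Max_le_iff) (use finite_imageI[OF finite_budget_choices[of B]] in auto)
qed

lemma integrable_best: "integrable P (best B)"
proof (rule integrable_const_bound[of _ "real T"])
  show "AE \<omega> in P. norm (best B \<omega>) \<le> real T"
    using AE_ability by eventually_elim (use best_ge[of "{}" B] best_le in auto)
qed simp

lemma policy_values:
  assumes "a \<in> policies F B T" "t \<in> {1..T}" "\<omega> \<in> space P"
  shows "a t \<omega> = 0 \<or> a t \<omega> = 1"
proof -
  have "a t \<in> history F T t \<rightarrow>\<^sub>M count_space {0, 1}"
    using assms(1,2) unfolding policies_def by blast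
  from measurable_space[OF this, of \<omega>] show ?thesis using assms(3) by simp
qed

lemma policy_history:
  assumes "a \<in> policies F B T" "t \<in> {1..T}"
  shows "(\<lambda>\<omega>. real (a t \<omega>)) \<in> borel_measurable (history F T t)"
proof -
  have "a t \<in> history F T t \<rightarrow>\<^sub>M count_space {0, 1}"
    using assms unfolding policies_def by blast
  thus ?thesis by (rule measurable_compose) simp
qed

lemma policy_measurable:
  assumes "a \<in> policies F B T" "t \<in> {1..T}"
  shows "(\<lambda>\<omega>. real (a t \<omega>)) \<in> borel_measurable P"
  using assms(2) by (intro measurable_history[OF _ policy_history[OF assms]]) simp

lemma integrable_collected:
  assumes a: "a \<in> policies F B T"
  shows "integrable P (\<lambda>\<omega>. \<Sum>t=1..T. ability t \<omega> * real (a t \<omega>))"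
proof (intro Bochner_Integration.integrable_sum integrable_const_bound[of _ 1])
  fix t assume t: "t \<in> {1..T}"
  show "AE \<omega> in P. norm (ability t \<omega> * real (a t \<omega>)) \<le> 1"
    using AE_ability AE_space
  proof eventually_elim
    case (elim \<omega>)
    thus ?case using policy_values[OF a t elim(2)] t by (auto simp: abs_mult)
  qed
  show "(\<lambda>\<omega>. ability t \<omega> * real (a t \<omega>)) \<in> borel_measurable P"
    using t by (intro borel_measurable_times measurable_ability policy_measurable[OF a])
qed

lemma regret_eq:
  assumes "a \<in> policies F B T"
  shows "regret F B T a = (\<integral>\<omega>. best B \<omega> - (\<Sum>t=1..T. ability t \<omega> * real (a t \<omega>)) \<partial>P)"
  using integrable_best integrable_collected[OF assms]
  by (simp add: regret_def hindsight_value_def best_def[abs_def])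

text \<open>
  If the positive abilities fit into the budget, the hindsight optimum hires all of them, and every rejection
  loses the whole ability. Restricting to a set \<open>I\<close> of periods is harmless because all losses are nonnegative.
\<close>
lemma gap_when_positive_fit:
  assumes nonneg: "\<And>t. t \<in> {1..T} \<Longrightarrow> ability t \<omega> \<ge> 0"
    and a: "\<And>t. t \<in> {1..T} \<Longrightarrow> a t = 0 \<or> a t = (1::nat)"
    and few: "card {t\<in>{1..T}. ability t \<omega> > 0} \<le> B"
    and I: "I \<subseteq> {1..T}"
  shows "(\<Sum>t\<in>I. ability t \<omega> * (1 - real (a t)))
           \<le> best B \<omega> - (\<Sum>t=1..T. ability t \<omega> * real (a t))"
proof -
  have "(\<Sum>t=1..T. ability t \<omega>) = (\<Sum>t\<in>{t\<in>{1..T}. ability t \<omega> > 0}. ability t \<omega>)"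
    using nonneg by (intro sum.mono_neutral_right) (auto simp: not_less intro: antisym)
  also have "\<dots> \<le> best B \<omega>" using few by (intro best_ge) auto
  finally have "(\<Sum>t=1..T. ability t \<omega> * (1 - real (a t)))
      \<le> best B \<omega> - (\<Sum>t=1..T. ability t \<omega> * real (a t))"
    by (simp add: algebra_simps sum_subtractf)
  moreover have "(\<Sum>t\<in>I. ability t \<omega> * (1 - real (a t))) \<le> (\<Sum>t=1..T. ability t \<omega> * (1 - real (a t)))"
  proof (intro sum_mono2 I)
    fix t assume "t \<in> {1..T} - I"
    hence "t \<in> {1..T}" by simp
    from nonneg[OF this] a[OF this] show "0 \<le> ability t \<omega> * (1 - real (a t))" by auto
  qed simp
  ultimately show ?thesis by simp
qed

text \<open>
  If \<open>B\<close> candidates reach the level \<open>v\<close>, each hire below \<open>v\<close> can be exchanged for an unused candidate at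
  or above \<open>v\<close>, which gains at least the shortfall.
\<close>
lemma gap_when_level_full:
  assumes a: "\<And>t. t \<in> {1..T} \<Longrightarrow> a t = 0 \<or> a t = (1::nat)"
    and budget: "(\<Sum>t=1..T. a t) \<le> B"
    and many: "B \<le> card {t\<in>{1..T}. ability t \<omega> \<ge> v}"
    and I: "I \<subseteq> {1..T}"
  shows "(\<Sum>t\<in>I. max 0 (v - ability t \<omega>) * real (a t))
           \<le> best B \<omega> - (\<Sum>t=1..T. ability t \<omega> * real (a t))"
proof -
  define S where "S = {t\<in>{1..T}. a t = 1}"
  define A where "A = {t\<in>{1..T}. ability t \<omega> \<ge> v}"
  have fin: "finite S" "finite A" and sub: "S \<subseteq> {1..T}" "A \<subseteq> {1..T}" by (auto simp: S_def A_def)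
  have a_S: "real (a t) = (if t \<in> S then 1 else 0)" if "t \<in> {1..T}" for t
    using a[OF that] that by (auto simp: S_def)
  have S_T: "S \<inter> {1..T} = S" by (auto simp: S_def)
  have sum_S: "(\<Sum>t=1..T. f t * real (a t)) = (\<Sum>t\<in>S. f t)" for f :: "nat \<Rightarrow> real"
  proof -
    have "(\<Sum>t=1..T. f t * real (a t)) = (\<Sum>t=1..T. if t \<in> S then f t else 0)"
      by (intro sum.cong refl) (simp only: a_S, simp)
    thus ?thesis using S_T by (simp add: sum.If_cases Int_commute)
  qed
  have "real (\<Sum>t=1..T. a t) = real (card S)" using sum_S[of "\<lambda>_. 1"] by simp
  hence card_S: "card S \<le> B" using budget by (simp only: of_nat_eq_iff)
  have "B \<le> card A" using many by (simp add: A_def)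
  hence "card (S - A) \<le> card (A - S)"
    using card_S fin card_Diff_subset_Int[of S A] card_Diff_subset_Int[of A S]
    by (simp add: Int_commute)
  then obtain D where D: "D \<subseteq> A - S" "card D = card (S - A)" "finite D"
    by (rule obtain_subset_with_card_n)
  have "card (S \<inter> A \<union> D) = card (S \<inter> A) + card (S - A)"
    using D fin by (subst card_Un_disjoint) auto
  also have "\<dots> = card S" using fin by (subst card_Int_Diff[of S A]) auto
  finally have "(\<Sum>t\<in>S \<inter> A \<union> D. ability t \<omega>) \<le> best B \<omega>"
    using card_S sub D by (intro best_ge) auto
  moreover have "(\<Sum>t\<in>S \<inter> A \<union> D. ability t \<omega>) = (\<Sum>t\<in>S \<inter> A. ability t \<omega>) + (\<Sum>t\<in>D. ability t \<omega>)"
    using D fin by (intro sum.union_disjoint) auto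
  moreover have "(\<Sum>t\<in>D. ability t \<omega>) \<ge> real (card (S - A)) * v"
    using sum_bounded_below[of D v "\<lambda>t. ability t \<omega>"] D by (auto simp: A_def)
  moreover have "(\<Sum>t\<in>S. ability t \<omega>) = (\<Sum>t\<in>S \<inter> A. ability t \<omega>) + (\<Sum>t\<in>S - A. ability t \<omega>)"
    using fin by (subst sum.Int_Diff[of S _ A]) auto
  moreover have "(\<Sum>t\<in>S. max 0 (v - ability t \<omega>)) = (\<Sum>t\<in>S - A. v - ability t \<omega>)"
    using fin by (intro sum.mono_neutral_cong_right) (auto simp: A_def S_def)
  moreover have "(\<Sum>t\<in>S - A. v - ability t \<omega>) = real (card (S - A)) * v - (\<Sum>t\<in>S - A. ability t \<omega>)"
    by (simp add: sum_subtractf)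
  ultimately have "(\<Sum>t\<in>S. max 0 (v - ability t \<omega>)) \<le> best B \<omega> - (\<Sum>t\<in>S. ability t \<omega>)"
    by linarith
  moreover have "(\<Sum>t\<in>I. max 0 (v - ability t \<omega>) * real (a t)) \<le> (\<Sum>t=1..T. max 0 (v - ability t \<omega>) * real (a t))"
    using I by (intro sum_mono2) auto
  ultimately show ?thesis unfolding sum_S by simp
qed

lemma gap_nonneg:
  assumes a: "\<And>t. t \<in> {1..T} \<Longrightarrow> a t = 0 \<or> a t = (1::nat)"
    and budget: "(\<Sum>t=1..T. a t) \<le> B"
  shows "0 \<le> best B \<omega> - (\<Sum>t=1..T. ability t \<omega> * real (a t))"
proof -
  define S where "S = {t\<in>{1..T}. a t = 1}"
  have a_S: "real (a t) = (if t \<in> S then 1 else 0)" if "t \<in> {1..T}" for t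
    using a[OF that] that by (auto simp: S_def)
  have S_T: "S \<inter> {1..T} = S" by (auto simp: S_def)
  have sum_S: "(\<Sum>t=1..T. f t * real (a t)) = (\<Sum>t\<in>S. f t)" for f :: "nat \<Rightarrow> real"
  proof -
    have "(\<Sum>t=1..T. f t * real (a t)) = (\<Sum>t=1..T. if t \<in> S then f t else 0)"
      by (intro sum.cong refl) (simp only: a_S, simp)
    thus ?thesis using S_T by (simp add: sum.If_cases Int_commute)
  qed
  have "real (\<Sum>t=1..T. a t) = real (card S)" using sum_S[of "\<lambda>_. 1"] by simp
  hence "card S \<le> B" using budget by (simp only: of_nat_eq_iff)
  hence "(\<Sum>t\<in>S. ability t \<omega>) \<le> best B \<omega>" by (intro best_ge) (auto simp: S_def)
  thus ?thesis unfolding sum_S by simp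
qed

definition tally :: "nat set \<Rightarrow> real set \<Rightarrow> scenario \<Rightarrow> nat" where
  "tally J A \<omega> = card {t\<in>J. ability t \<omega> \<in> A}"

lemma tally_eq_sum: "finite J \<Longrightarrow> real (tally J A \<omega>) = (\<Sum>t\<in>J. indicator A (ability t \<omega>))"
  by (simp add: tally_def indicator_def sum.If_cases Int_def)

end

text \<open>
  Conditioning on one trial. This recursion both yields the moments and identifies the law of a tally,
  which satisfies the same one.
\<close>
lemma expectation_binomial_Suc:
  fixes f :: "nat \<Rightarrow> real"
  assumes p: "p \<in> {0..1}"
  shows "measure_pmf.expectation (binomial_pmf (Suc n) p) f =
    p * measure_pmf.expectation (binomial_pmf n p) (\<lambda>k. f (Suc k))
    + (1 - p) * measure_pmf.expectation (binomial_pmf n p) f"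
proof -
  have fin: "finite (set_pmf (binomial_pmf n p))" using p by (rule finite_set_pmf_binomial_pmf)
  have "measure_pmf.expectation (binomial_pmf (Suc n) p) f =
    (\<Sum>b\<in>UNIV. pmf (bernoulli_pmf p) b *\<^sub>R
      measure_pmf.expectation (map_pmf (\<lambda>k. (if b then 1 else 0) + k) (binomial_pmf n p)) f)"
    unfolding binomial_pmf_Suc[OF p] map_pmf_def[symmetric]
    by (subst pmf_expectation_bind[of UNIV]) (use fin in \<open>auto simp: map_pmf_def\<close>)
  thus ?thesis using p by (simp add: UNIV_bool)
qed

text \<open>
  The shift \<open>y\<close> makes the induction on the number of trials close: splitting off one trial turns a
  moment at \<open>y\<close> into moments at \<open>y + 1 - p\<close> and \<open>y - p\<close>.
\<close>
lemma binomial_central_moments: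
  fixes p y :: real
  assumes p: "p \<in> {0..1}"
  defines "v \<equiv> p * (1 - p)"
  shows "measure_pmf.expectation (binomial_pmf n p) (\<lambda>k. real k - n * p + y) = y" (is ?m1)
    and "measure_pmf.expectation (binomial_pmf n p) (\<lambda>k. (real k - n * p + y)^2) = y^2 + n * v" (is ?m2)
    and "measure_pmf.expectation (binomial_pmf n p) (\<lambda>k. (real k - n * p + y)^3)
           = y^3 + 3 * n * v * y + n * v * (1 - 2 * p)" (is ?m3)
    and "measure_pmf.expectation (binomial_pmf n p) (\<lambda>k. (real k - n * p + y)^4)
           = y^4 + 6 * n * v * y^2 + 4 * n * v * (1 - 2 * p) * y + n * v * (1 - 6 * v) + 3 * n^2 * v^2" (is ?m4)
proof -
  have shift: "real (Suc k) - real (Suc n) * p + y = real k - n * p + (y + 1 - p)"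
    "real k - real (Suc n) * p + y = real k - n * p + (y - p)" for k n y
    by (simp_all add: algebra_simps)
  show ?m1
  proof (induction n arbitrary: y)
    case (Suc n) show ?case
      unfolding expectation_binomial_Suc[OF p] unfolding shift(1) unfolding shift(2) Suc.IH
      by (simp add: algebra_simps)
  qed (simp add: binomial_pmf_0[OF p])
  show ?m2
  proof (induction n arbitrary: y)
    case (Suc n) show ?case
      unfolding expectation_binomial_Suc[OF p] unfolding shift(1) unfolding shift(2) Suc.IH
      by (simp add: v_def algebra_simps power2_eq_square)
  qed (simp add: binomial_pmf_0[OF p])
  show ?m3
  proof (induction n arbitrary: y)
    case (Suc n) show ?case
      unfolding expectation_binomial_Suc[OF p] unfolding shift(1) unfolding shift(2) Suc.IH
      by (simp add: v_def algebra_simps power2_eq_square power3_eq_cube)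
  qed (simp add: binomial_pmf_0[OF p])
  show ?m4
  proof (induction n arbitrary: y)
    case (Suc n) show ?case
      unfolding expectation_binomial_Suc[OF p] unfolding shift(1) unfolding shift(2) Suc.IH
      by (simp add: v_def algebra_simps power2_eq_square power3_eq_cube power4_eq_xxxx)
  qed (simp add: binomial_pmf_0[OF p])
qed

context multisecretary begin

lemma expectation_tally:
  fixes f :: "nat \<Rightarrow> real"
  assumes A [measurable]: "A \<in> sets borel" and J: "J \<subseteq> {1..T}"
  shows "(\<integral>\<omega>. f (tally J A \<omega>) \<partial>P) = measure_pmf.expectation (binomial_pmf (card J) (measure F A)) f"
proof -
  interpret F: prob_space F by (rule prob_space_F)
  have "finite J" using J by (rule finite_subset) simp
  define X where "X = (\<lambda>t \<omega>. indicator A (ability t \<omega>) :: real)"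
  have X_meas: "X t \<in> borel_measurable P" if "t \<in> {1..T}" for t
    using measurable_ability[OF that] unfolding X_def by measurable
  have indep: "indep_vars (\<lambda>_. borel) X {1..T}"
    unfolding X_def by (rule indep_vars_compose2[OF indep_vars_abilities]) simp
  have E_X: "expectation (X t) = measure F A" if "t \<in> {1..T}" for t
  proof -
    have "expectation (X t) = integral\<^sup>L (distr P borel (ability t)) (indicator A)"
      unfolding X_def using measurable_ability[OF that] by (subst integral_distr) auto
    thus ?thesis using that by (simp add: distr_ability)
  qed
  from \<open>finite J\<close> J show ?thesis
  proof (induction J arbitrary: f rule: finite_induct)
    case empty thus ?case using F.prob_le_1[of A] by (simp add: tally_def prob_space binomial_pmf_0)
  next
    case (insert j J)
    have j: "j \<in> {1..T}" and J: "J \<subseteq> {1..T}" using insert by auto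
    let ?c = "\<lambda>\<omega>. \<Sum>t\<in>J. X t \<omega>"
    have c: "real (tally J A \<omega>) = ?c \<omega>" for \<omega>
      unfolding X_def using insert(1) by (rule tally_eq_sum)
    have c_meas: "?c \<in> borel_measurable P"
      using J by (intro borel_measurable_sum X_meas) auto
    have ind: "indep_var borel (X j) borel ?c"
      using insert by (intro indep_vars_sum indep_vars_subset[OF indep]) auto
    have bound: "\<bar>g (tally J A \<omega>)\<bar> \<le> (\<Sum>k\<le>card J. \<bar>g k\<bar>)" for g :: "nat \<Rightarrow> real" and \<omega>
      using insert(1) by (intro member_le_sum[of _ _ "\<lambda>k. \<bar>g k\<bar>"]) (auto simp: tally_def intro: card_mono)
    have meas: "(\<lambda>\<omega>. g (tally J A \<omega>)) \<in> borel_measurable P" for g :: "nat \<Rightarrow> real"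
    proof -
      have "(\<lambda>\<omega>. g (tally J A \<omega>)) = (\<lambda>\<omega>. g (nat \<lfloor>?c \<omega>\<rfloor>))"
        by (simp add: c[symmetric])
      thus ?thesis using c_meas by simp
    qed
    have int: "integrable P (\<lambda>\<omega>. g (tally J A \<omega>))" for g :: "nat \<Rightarrow> real"
      using bound meas by (intro integrable_const_bound[of _ "\<Sum>k\<le>card J. \<bar>g k\<bar>"]) auto
    have int_X: "integrable P (X j)"
      using X_meas[OF j] by (intro integrable_const_bound[of _ 1]) (auto simp: X_def indicator_def)
    have mult: "(\<integral>\<omega>. X j \<omega> * g (tally J A \<omega>) \<partial>P)
        = measure F A * (\<integral>\<omega>. g (tally J A \<omega>) \<partial>P)"
      and int_mult: "integrable P (\<lambda>\<omega>. X j \<omega> * g (tally J A \<omega>))" for g :: "nat \<Rightarrow> real"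
    proof -
      have "indep_var borel (id \<circ> X j) borel ((\<lambda>x. g (nat \<lfloor>x\<rfloor>)) \<circ> ?c)"
        by (rule indep_var_compose[OF ind]) auto
      also have "(\<lambda>x. g (nat \<lfloor>x\<rfloor>)) \<circ> ?c = (\<lambda>\<omega>. g (tally J A \<omega>))"
        by (simp add: fun_eq_iff c[symmetric])
      finally have I: "indep_var borel (X j) borel (\<lambda>\<omega>. g (tally J A \<omega>))" by simp
      show "(\<integral>\<omega>. X j \<omega> * g (tally J A \<omega>) \<partial>P) = measure F A * (\<integral>\<omega>. g (tally J A \<omega>) \<partial>P)"
        using indep_var_lebesgue_integral[OF I int_X int] E_X[OF j] by simp
      show "integrable P (\<lambda>\<omega>. X j \<omega> * g (tally J A \<omega>))"
        using indep_var_integrable[OF I int_X int] .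
    qed
    have split: "f (tally (insert j J) A \<omega>)
      = X j \<omega> * f (Suc (tally J A \<omega>)) + f (tally J A \<omega>) - X j \<omega> * f (tally J A \<omega>)" for \<omega>
    proof (cases "ability j \<omega> \<in> A")
      case True
      hence "{t\<in>insert j J. ability t \<omega> \<in> A} = insert j {t\<in>J. ability t \<omega> \<in> A}" by auto
      thus ?thesis using True insert(1,2) by (simp add: X_def tally_def)
    next
      case False
      hence "{t\<in>insert j J. ability t \<omega> \<in> A} = {t\<in>J. ability t \<omega> \<in> A}" by auto
      thus ?thesis using False by (simp add: X_def tally_def)
    qed
    have "(\<integral>\<omega>. f (tally (insert j J) A \<omega>) \<partial>P)
      = measure F A * (\<integral>\<omega>. f (Suc (tally J A \<omega>)) \<partial>P) + (1 - measure F A) * (\<integral>\<omega>. f (tally J A \<omega>) \<partial>P)"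
      unfolding split using int[of f] int_mult[of "\<lambda>k. f (Suc k)"] int_mult[of f]
      by (simp add: mult[of f] mult[of "\<lambda>k. f (Suc k)"] algebra_simps)
    thus ?case using insert(1,2) F.prob_le_1[of A]
      unfolding insert.IH[OF J, of f] insert.IH[OF J, of "\<lambda>k. f (Suc k)"]
      by (simp add: expectation_binomial_Suc)
  qed
qed

end

section \<open>Laws given by quantile functions\<close>

definition quantile_law :: "(real \<Rightarrow> real) \<Rightarrow> real measure" where
  "quantile_law Q = distr (uniform_measure lborel {0..1}) borel Q"

locale quantile_function =
  fixes Q :: "real \<Rightarrow> real"
  assumes mono: "mono Q" and cont: "continuous_on UNIV Q" and Q0: "0 \<le> Q 0" and Q1: "Q 1 \<le> 1"
begin

lemma borel_measurable_Q [measurable]: "Q \<in> borel_measurable borel"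
  using cont by (rule borel_measurable_continuous_onI)

lemma measure_quantile_law:
  assumes [measurable]: "A \<in> sets borel"
  shows "measure (quantile_law Q) A = measure lborel ({0..1} \<inter> Q -` A)"
proof -
  have m: "Q -` A \<in> sets lborel" using measurable_sets[OF borel_measurable_Q assms] by simp
  have "measure (quantile_law Q) A = measure (uniform_measure lborel {0..1}) (Q -` A)"
    unfolding quantile_law_def by (subst measure_distr) auto
  also have "\<dots> = measure lborel ({0..1} \<inter> Q -` A)"
    using m by (subst measure_uniform_measure) auto
  finally show ?thesis .
qed

lemma ability_distribution_quantile_law: "ability_distribution (quantile_law Q)"
proof -
  interpret U: prob_space "uniform_measure lborel {0..1::real}"
    by (rule prob_space_uniform_measure) auto
  have "prob_space (quantile_law Q)"
    unfolding quantile_law_def by (rule U.prob_space_distr) simp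
  moreover have "{0..1} \<inter> Q -` {0..1} = {0..1}"
  proof -
    have "Q x \<in> {0..1}" if "x \<in> {0..1}" for x
      using monoD[OF mono, of 0 x] monoD[OF mono, of x 1] Q0 Q1 that by auto
    thus ?thesis by blast
  qed
  hence "measure (quantile_law Q) {0..1} = 1"
    by (simp add: measure_quantile_law)
  ultimately show ?thesis
    by (auto simp: ability_distribution_def real_distribution_def real_distribution_axioms_def
        quantile_law_def)
qed

text \<open>
  Monotonicity alone gives \<open>F (Q q) \<ge> q\<close>; continuity excludes a smaller value \<open>v < Q q\<close>, since then \<open>Q\<close>
  exceeds \<open>v\<close> already slightly to the left of \<open>q\<close>.
\<close>
lemma quantile_quantile_law:
  assumes q: "0 < q" "q \<le> 1"
  shows "quantile (quantile_law Q) q = Q q"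
proof -
  have cdf: "cdf (quantile_law Q) v = measure lborel ({0..1} \<inter> Q -` {..v})" for v
    by (simp add: cdf_def measure_quantile_law)
  have m: "{0..1} \<inter> Q -` {..v} \<in> fmeasurable lborel" for v
  proof (rule fmeasurableI2[of "{0..1}"])
    show "{0..1} \<inter> Q -` {..v} \<in> sets lborel"
      using measurable_sets[OF borel_measurable_Q, of "{..v}"] by auto
    show "{0..1::real} \<in> fmeasurable lborel" by (rule fmeasurableI) auto
  qed auto
  have "cdf (quantile_law Q) v \<ge> q \<longleftrightarrow> Q q \<le> v" for v
  proof
    assume "Q q \<le> v"
    hence "Q x \<le> v" if "x \<le> q" for x using monoD[OF mono that] by simp
    hence "{0..q} \<subseteq> {0..1} \<inter> Q -` {..v}" using q by auto
    from measure_mono_fmeasurable[OF this _ m] show "cdf (quantile_law Q) v \<ge> q"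
      using q by (simp add: cdf)
  next
    assume *: "cdf (quantile_law Q) v \<ge> q"
    show "Q q \<le> v"
    proof (rule ccontr)
      assume "\<not> Q q \<le> v"
      moreover have "(Q \<longlongrightarrow> Q q) (at_left q)"
        using cont by (auto simp: continuous_on_def intro: tendsto_within_subset)
      ultimately have "\<forall>\<^sub>F x in at_left q. v < Q x" by (auto intro: order_tendstoD)
      moreover have "\<forall>\<^sub>F x in at_left q. x \<in> {0<..<q}" by (rule eventually_at_leftI[of 0]) (use q in auto)
      ultimately have "\<exists>x. v < Q x \<and> x \<in> {0<..<q}"
        by (intro eventually_happens'[of "at_left q"] eventually_conj) auto
      then obtain x where x: "v < Q x" "0 < x" "x < q" by auto
      have "{0..1} \<inter> Q -` {..v} \<subseteq> {0..x}"
      proof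
        fix u assume u: "u \<in> {0..1} \<inter> Q -` {..v}"
        hence "\<not> x \<le> u" using monoD[OF mono, of x u] x(1) by auto
        thus "u \<in> {0..x}" using u by auto
      qed
      moreover have "{0..x} \<in> fmeasurable lborel" using x by (intro fmeasurableI) auto
      ultimately have "cdf (quantile_law Q) v \<le> measure lborel {0..x}"
        unfolding cdf using fmeasurableD[OF m] by (intro measure_mono_fmeasurable)
      hence "cdf (quantile_law Q) v \<le> x" using x by simp
      thus False using * x by simp
    qed
  qed
  thus ?thesis by (simp add: quantile_def atLeast_def[symmetric])
qed

text \<open>
  A Hoelder quantile function has no gaps at all, so a single cluster \<open>(0, 1]\<close> suffices.
\<close>
lemma quantile_law_clustered:
  assumes \<beta>: "\<beta> \<ge> 0"
    and holder: "\<And>q q'. \<bar>Q q - Q q'\<bar> \<le> C * \<bar>q - q'\<bar> powr (1 / (\<beta> + 1))"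
  shows "quantile_law Q \<in> clustered_class \<beta> (1/2)"
  unfolding clustered_class_def clustered_def
proof (intro CollectI conjI ability_distribution_quantile_law exI)
  show "\<forall>i\<in>{1..0 + 1}. \<forall>q\<in>{real (i - 1)<..real i}. \<forall>q'\<in>{real (i - 1)<..real i}.
      \<bar>quantile (quantile_law Q) q - quantile (quantile_law Q) q'\<bar> \<le> C * \<bar>q - q'\<bar> powr (1 / (\<beta> + 1)) + 0"
    using holder by (simp add: quantile_quantile_law)
qed (use \<beta> in auto)

end

text \<open>
  Subadditivity of \<open>x \<mapsto> x powr \<alpha>\<close>, by scaling to the fractions \<open>y/x\<close> and \<open>(x - y)/x\<close>, which sum to \<open>1\<close>
  and do not exceed their \<open>\<alpha>\<close>-th powers.
\<close>
lemma powr_diff_le: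
  fixes x y \<alpha> :: real
  assumes "0 \<le> y" "y \<le> x" "0 < \<alpha>" "\<alpha> \<le> 1"
  shows "x powr \<alpha> - y powr \<alpha> \<le> (x - y) powr \<alpha>"
proof (cases "x = 0")
  case False
  hence x: "x > 0" using assms by simp
  have "z \<le> z powr \<alpha>" if "0 \<le> z" "z \<le> 1" for z :: real
    using that assms powr_mono'[of \<alpha> 1 z] by simp
  from this[of "y / x"] this[of "(x - y) / x"]
  have "y / x + (x - y) / x \<le> (y / x) powr \<alpha> + ((x - y) / x) powr \<alpha>"
    using assms x by (intro add_mono) auto
  moreover have "y / x + (x - y) / x = 1" using x by (simp add: field_simps)
  ultimately have "1 \<le> (y powr \<alpha> + (x - y) powr \<alpha>) / x powr \<alpha>"
    using assms x by (simp add: powr_divide add_divide_distrib)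
  thus ?thesis using x by (simp add: field_simps)
qed (use assms in auto)

lemma pospart_powr_holder:
  fixes x y \<alpha> :: real
  assumes "0 < \<alpha>" "\<alpha> \<le> 1"
  shows "\<bar>max 0 x powr \<alpha> - max 0 y powr \<alpha>\<bar> \<le> \<bar>x - y\<bar> powr \<alpha>"
proof -
  have *: "\<bar>max 0 x powr \<alpha> - max 0 y powr \<alpha>\<bar> \<le> \<bar>x - y\<bar> powr \<alpha>" if "y \<le> x" for x y
  proof -
    have le: "max 0 y \<le> max 0 x" using that by simp
    have "max 0 x powr \<alpha> - max 0 y powr \<alpha> \<le> (max 0 x - max 0 y) powr \<alpha>"
      using le assms by (intro powr_diff_le) auto
    also have "\<dots> \<le> \<bar>x - y\<bar> powr \<alpha>" using le that assms by (intro powr_mono2) auto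
    finally show ?thesis using powr_mono2[of \<alpha> "max 0 y" "max 0 x"] le assms by simp
  qed
  show ?thesis using *[of y x] *[of x y] by (cases "y \<le> x") (auto simp: abs_minus_commute)
qed

text \<open>Steep to the right of the median and constant to its left: half of the candidates are
  worthless, which makes the lower hindsight price \<open>0\<close>.\<close>
definition hinge_quantile :: "real \<Rightarrow> real \<Rightarrow> real" where
  "hinge_quantile \<alpha> q = max 0 (2 * q - 1) powr \<alpha>"

lemma hinge_quantile_function:
  assumes "0 < \<alpha>"
  shows "quantile_function (hinge_quantile \<alpha>)"
proof
  show "mono (hinge_quantile \<alpha>)"
    unfolding hinge_quantile_def using assms by (intro monoI powr_mono2) auto
  show "continuous_on UNIV (hinge_quantile \<alpha>)"
    unfolding hinge_quantile_def using assms by (intro continuous_on_powr' continuous_intros) auto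
qed (auto simp: hinge_quantile_def)

lemma hinge_law_clustered:
  assumes "\<beta> \<ge> 0"
  shows "quantile_law (hinge_quantile (1 / (\<beta> + 1))) \<in> clustered_class \<beta> (1/2)"
proof -
  let ?\<alpha> = "1 / (\<beta> + 1)"
  have \<alpha>: "0 < ?\<alpha>" "?\<alpha> \<le> 1" using assms by auto
  interpret quantile_function "hinge_quantile ?\<alpha>" using \<alpha>(1) by (rule hinge_quantile_function)
  show ?thesis
  proof (rule quantile_law_clustered[OF assms, of "2 powr ?\<alpha>"])
    fix q q' :: real
    have "\<bar>hinge_quantile ?\<alpha> q - hinge_quantile ?\<alpha> q'\<bar> \<le> \<bar>(2 * q - 1) - (2 * q' - 1)\<bar> powr ?\<alpha>"
      unfolding hinge_quantile_def by (rule pospart_powr_holder[OF \<alpha>])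
    also have "\<bar>(2 * q - 1) - (2 * q' - 1)\<bar> = 2 * \<bar>q - q'\<bar>" by (simp add: abs_if)
    also have "\<dots> powr ?\<alpha> = 2 powr ?\<alpha> * \<bar>q - q'\<bar> powr ?\<alpha>" by (simp add: powr_mult)
    finally show "\<bar>hinge_quantile ?\<alpha> q - hinge_quantile ?\<alpha> q'\<bar> \<le> 2 powr ?\<alpha> * \<bar>q - q'\<bar> powr ?\<alpha>" .
  qed
qed

lemma hinge_quantile_le_iff:
  assumes "0 < \<alpha>" "1/2 \<le> b"
  shows "hinge_quantile \<alpha> b \<le> hinge_quantile \<alpha> u \<longleftrightarrow> b \<le> max (1/2) u"
proof
  assume *: "hinge_quantile \<alpha> b \<le> hinge_quantile \<alpha> u"
  show "b \<le> max (1/2) u"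
  proof (rule ccontr)
    assume "\<not> b \<le> max (1/2) u"
    hence "hinge_quantile \<alpha> u < hinge_quantile \<alpha> b"
      unfolding hinge_quantile_def using assms by (intro powr_less_mono2) auto
    thus False using * by simp
  qed
next
  assume "b \<le> max (1/2) u"
  thus "hinge_quantile \<alpha> b \<le> hinge_quantile \<alpha> u"
    unfolding hinge_quantile_def using assms by (intro powr_mono2) auto
qed

lemma measure_hinge_law:
  assumes \<alpha>: "0 < \<alpha>"
  shows "measure (quantile_law (hinge_quantile \<alpha>)) {0<..} = 1/2"
    and "1/2 < b \<Longrightarrow> b \<le> 1 \<Longrightarrow> measure (quantile_law (hinge_quantile \<alpha>)) {hinge_quantile \<alpha> b..} = 1 - b"
    and "1/2 < b \<Longrightarrow> b \<le> c \<Longrightarrow> c \<le> 1 \<Longrightarrow>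
      measure (quantile_law (hinge_quantile \<alpha>)) {hinge_quantile \<alpha> b..hinge_quantile \<alpha> c} = c - b"
proof -
  interpret quantile_function "hinge_quantile \<alpha>" using \<alpha> by (rule hinge_quantile_function)
  have "{0..1} \<inter> hinge_quantile \<alpha> -` {0<..} = {1/2<..1}"
    by (auto simp: hinge_quantile_def max_def split: if_splits)
  thus "measure (quantile_law (hinge_quantile \<alpha>)) {0<..} = 1/2" by (simp add: measure_quantile_law)
  show "measure (quantile_law (hinge_quantile \<alpha>)) {hinge_quantile \<alpha> b..} = 1 - b" if "1/2 < b" "b \<le> 1"
  proof -
    have "{0..1} \<inter> hinge_quantile \<alpha> -` {hinge_quantile \<alpha> b..} = {b..1}"
      using that hinge_quantile_le_iff[OF \<alpha>, of b] by (auto simp: max_def split: if_splits)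
    thus ?thesis using that by (simp add: measure_quantile_law)
  qed
  show "measure (quantile_law (hinge_quantile \<alpha>)) {hinge_quantile \<alpha> b..hinge_quantile \<alpha> c} = c - b"
    if "1/2 < b" "b \<le> c" "c \<le> 1"
  proof -
    have "hinge_quantile \<alpha> u \<le> hinge_quantile \<alpha> c \<longleftrightarrow> u \<le> c" if "u \<ge> b" for u
      using hinge_quantile_le_iff[OF \<alpha>, of u c] that \<open>1/2 < b\<close> \<open>b \<le> c\<close> by (auto simp: max_def)
    hence "{0..1} \<inter> hinge_quantile \<alpha> -` {hinge_quantile \<alpha> b..hinge_quantile \<alpha> c} = {b..c}"
      using that hinge_quantile_le_iff[OF \<alpha>, of b] by (auto simp: max_def split: if_splits)
    thus ?thesis using that by (simp add: measure_quantile_law)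
  qed
qed

section \<open>Binomial fluctuations\<close>

text \<open>
  Chebyshev's inequality, with the variance bounded by \<open>n/4\<close> for every success probability.
\<close>
lemma binomial_chebyshev:
  fixes p K :: real
  assumes p: "p \<in> {0..1}" and K: "K > 0"
  shows "measure_pmf.expectation (binomial_pmf n p) (\<lambda>k. of_bool (\<bar>real k - n * p\<bar> \<ge> K)) \<le> n / 4 / K\<^sup>2"
proof -
  have fin: "finite (set_pmf (binomial_pmf n p))" using p by (rule finite_set_pmf_binomial_pmf)
  note [simp] = integrable_measure_pmf_finite[OF fin]
  have "measure_pmf.expectation (binomial_pmf n p) (\<lambda>k. of_bool (\<bar>real k - n * p\<bar> \<ge> K))
      \<le> measure_pmf.expectation (binomial_pmf n p) (\<lambda>k. (real k - n * p + 0)\<^sup>2 / K\<^sup>2)"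
  proof (intro integral_mono)
    fix k
    show "of_bool (\<bar>real k - n * p\<bar> \<ge> K) \<le> (real k - n * p + 0)\<^sup>2 / K\<^sup>2"
      using K power_mono[of K "\<bar>real k - n * p\<bar>" 2] by (auto simp: field_simps)
  qed auto
  also have "\<dots> = n * (p * (1 - p)) / K\<^sup>2"
    by (simp only: integral_divide_zero binomial_central_moments[OF p]) simp
  also have "\<dots> \<le> n * (1 / 4) / K\<^sup>2"
  proof -
    have "p * (1 - p) \<le> 1 / 4" using zero_le_power2[of "p - 1/2"] by (simp add: power2_eq_square algebra_simps)
    thus ?thesis by (intro divide_right_mono mult_left_mono) auto
  qed
  finally show ?thesis by simp
qed

text \<open>
  A polynomial test function for the tail \<open>{r \<ge> 1/4}\<close>. It is positive only between the simple roots
  \<open>1/4\<close> and \<open>3\<close>. For a variable with moments \<open>0, 1, 0, 3\<close> (the standard normal ones) its mean is \<open>1\<close>,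
  so four moments already bound the tail from below.
\<close>
lemma quartic_below_indicator:
  fixes r :: real
  shows "(r - 1/4) * (r + 1)\<^sup>2 * (3 - r) \<le> 32 * of_bool (1/4 \<le> r)"
proof -
  consider "r < 1/4" | "1/4 \<le> r" "r \<le> 3" | "3 < r" by linarith
  thus ?thesis
  proof cases
    case 1
    hence "(r - 1/4) * (r + 1)\<^sup>2 * (3 - r) \<le> 0"
      by (intro mult_nonpos_nonneg) auto
    thus ?thesis using 1 by simp
  next
    case 2
    have "(r - 1/4) * (3 - r) \<le> 2"
      using zero_le_power2[of "r - 13/8"] by (simp add: power2_eq_square field_simps)
    moreover have "(r + 1)\<^sup>2 \<le> 4\<^sup>2" using 2 by (intro power_mono) auto
    ultimately have "((r - 1/4) * (3 - r)) * (r + 1)\<^sup>2 \<le> 2 * 16"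
      by (intro mult_mono) auto
    thus ?thesis using 2 by (simp add: algebra_simps)
  next
    case 3
    hence "(r - 1/4) * (r + 1)\<^sup>2 * (3 - r) \<le> 0"
      by (intro mult_nonneg_nonpos) auto
    thus ?thesis using 3 by simp
  qed
qed

text \<open>
  A quarter of a standard deviation is exceeded with constant probability, in either direction \<open>\<sigma>\<close>. The
  standardized binomial moments differ from the normal ones by \<open>O(1/s)\<close>, so for \<open>s \<ge> 10\<close> the quartic test
  function still has mean at least \<open>1/2\<close>.
\<close>
lemma binomial_anticoncentration:
  fixes p \<sigma> s :: real
  assumes p: "p \<in> {0..1}" and \<sigma>: "\<sigma> = 1 \<or> \<sigma> = -1" and s: "s = sqrt (n * (p * (1 - p)))" "s \<ge> 10"
  shows "measure_pmf.expectation (binomial_pmf n p) (\<lambda>k. of_bool (s / 4 \<le> \<sigma> * (real k - n * p))) \<ge> (1 / 64 :: real)"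
proof -
  have fin: "finite (set_pmf (binomial_pmf n p))" using p by (rule finite_set_pmf_binomial_pmf)
  note [simp] = integrable_measure_pmf_finite[OF fin]
  let ?E = "measure_pmf.expectation (binomial_pmf n p)"
  let ?z = "\<lambda>k. real k - n * p + 0"
  let ?g = "\<lambda>r::real. (r - 1/4) * (r + 1)\<^sup>2 * (3 - r)"
  have v0: "0 \<le> p * (1 - p)" using p by auto
  have s2: "n * (p * (1 - p)) = s\<^sup>2" using v0 by (simp add: s(1))
  \<comment> \<open>Expanding the quartic; odd powers keep the sign \<open>\<sigma>\<close>, even ones lose it.\<close>
  have expand: "?g (\<sigma> * ?z k / s) = (- 1 / s^4) * ?z k ^ 4 + (5/4 * \<sigma> / s^3) * ?z k ^ 3
      + (19/4 / s\<^sup>2) * (?z k)\<^sup>2 + (7/4 * \<sigma> / s) * ?z k - 3/4" for k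
  proof -
    have "?g (\<sigma> * y) = - (y ^ 4) + 5/4 * \<sigma> * y ^ 3 + 19/4 * y\<^sup>2 + 7/4 * \<sigma> * y - 3/4" for y :: real
      using \<sigma> by (auto simp: power2_eq_square power3_eq_cube power4_eq_xxxx field_simps)
    from this[of "?z k / s"] show ?thesis using s(2)
      by (simp add: power_divide)
  qed
  have "?E (\<lambda>k. ?g (\<sigma> * ?z k / s)) = (- 1 / s^4) * ?E (\<lambda>k. ?z k ^ 4) + (5/4 * \<sigma> / s^3) * ?E (\<lambda>k. ?z k ^ 3)
      + (19/4 / s\<^sup>2) * ?E (\<lambda>k. (?z k)\<^sup>2) + (7/4 * \<sigma> / s) * ?E ?z - 3/4"
    unfolding expand by simp
  also have "?E ?z = 0" using binomial_central_moments(1)[OF p, of n 0] by simp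
  also have "?E (\<lambda>k. (?z k)\<^sup>2) = s\<^sup>2"
    using binomial_central_moments(2)[OF p, of n 0] s2 by simp
  also have "?E (\<lambda>k. ?z k ^ 3) = s\<^sup>2 * (1 - 2 * p)"
    using binomial_central_moments(3)[OF p, of n 0] s2 by simp
  also have "?E (\<lambda>k. ?z k ^ 4) = s\<^sup>2 * (1 - 6 * (p * (1 - p))) + 3 * s ^ 4"
  proof -
    have "s ^ 4 = (real n)\<^sup>2 * (p * (1 - p))\<^sup>2"
      unfolding power_mult_distrib[symmetric] s2 by (simp add: power2_eq_square power4_eq_xxxx)
    thus ?thesis using binomial_central_moments(4)[OF p, of n 0] s2 by simp
  qed
  also have "(- 1 / s^4) * (s\<^sup>2 * (1 - 6 * (p * (1 - p))) + 3 * s ^ 4) + (5/4 * \<sigma> / s^3) * (s\<^sup>2 * (1 - 2 * p))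
      + (19/4 / s\<^sup>2) * s\<^sup>2 + (7/4 * \<sigma> / s) * 0 - 3/4
      = 1 - (1 - 6 * (p * (1 - p))) / s\<^sup>2 + 5/4 * (\<sigma> * (1 - 2 * p) / s)"
    using s(2) by (simp add: field_simps power2_eq_square power3_eq_cube power4_eq_xxxx)
  finally have E: "?E (\<lambda>k. ?g (\<sigma> * ?z k / s))
      = 1 - (1 - 6 * (p * (1 - p))) / s\<^sup>2 + 5/4 * (\<sigma> * (1 - 2 * p) / s)" .
  have "(1 - 6 * (p * (1 - p))) / s\<^sup>2 \<le> 1 / 10\<^sup>2"
    using v0 s(2) by (intro frac_le power_mono) auto
  hence "(1 - 6 * (p * (1 - p))) / s\<^sup>2 \<le> 1 / 100" by simp
  moreover have "- (\<sigma> * (1 - 2 * p)) / s \<le> 1 / 10"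
    using \<sigma> p s(2) by (intro frac_le) auto
  ultimately have "1 / 2 \<le> ?E (\<lambda>k. ?g (\<sigma> * ?z k / s))"
    unfolding E minus_divide_left[symmetric] by linarith
  also have "\<dots> \<le> ?E (\<lambda>k. 32 * of_bool (s / 4 \<le> \<sigma> * (real k - n * p)))"
  proof (intro integral_mono)
    fix k
    have "s / 4 \<le> \<sigma> * (real k - n * p) \<longleftrightarrow> 1 / 4 \<le> \<sigma> * ?z k / s"
      using s(2) by (simp add: field_simps)
    thus "?g (\<sigma> * ?z k / s) \<le> 32 * of_bool (s / 4 \<le> \<sigma> * (real k - n * p))"
      using quartic_below_indicator[of "\<sigma> * ?z k / s"] by simp
  qed auto
  finally show ?thesis by simp
qed

context multisecretary begin

lemma tally_history:
  assumes "A \<in> sets borel" "J \<subseteq> {1..t}"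
  shows "(\<lambda>\<omega>. real (tally J A \<omega>)) \<in> borel_measurable (history F T t)"
proof -
  have "finite J" using assms(2) by (rule finite_subset) simp
  have "(\<lambda>\<omega>. \<Sum>s\<in>J. indicator A (ability s \<omega>) :: real) \<in> borel_measurable (history F T t)"
    using assms by (intro borel_measurable_sum measurable_compose[OF ability_history]) auto
  thus ?thesis using \<open>finite J\<close> by (simp add: tally_eq_sum)
qed

lemma expectation_history_future_tally:
  fixes X :: "scenario \<Rightarrow> real"
  assumes X: "X \<in> borel_measurable (history F T t)" "\<forall>\<omega>\<in>space P. \<bar>X \<omega>\<bar> \<le> 1" and t: "t \<le> T"
    and A: "A \<in> sets borel" and h: "h \<in> borel_measurable borel" "\<And>x. \<bar>h x\<bar> \<le> (1::real)"
  shows "expectation (\<lambda>\<omega>. X \<omega> * h (real (tally {t<..T} A \<omega>)))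
    = expectation X * expectation (\<lambda>\<omega>. h (real (tally {t<..T} A \<omega>)))"
    and "integrable P X"
    and "integrable P (\<lambda>\<omega>. X \<omega> * h (real (tally {t<..T} A \<omega>)))"
proof -
  let ?g = "\<lambda>f. h (\<Sum>s\<in>{t<..T}. indicator A (f s))"
  have "?g \<in> borel_measurable (PiM {t<..T} (\<lambda>_. borel :: real measure))"
    using A h(1) by measurable
  from indep_history_future[OF X(1) t this]
  have "indep_var borel X borel (\<lambda>\<omega>. ?g (\<lambda>s\<in>{t<..T}. ability s \<omega>))" .
  also have "(\<lambda>\<omega>. ?g (\<lambda>s\<in>{t<..T}. ability s \<omega>)) = (\<lambda>\<omega>. h (real (tally {t<..T} A \<omega>)))"
    unfolding tally_eq_sum[OF finite_greaterThanAtMost]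
    by (intro ext arg_cong[of _ _ h] sum.cong) auto
  finally have I: "indep_var borel X borel (\<lambda>\<omega>. h (real (tally {t<..T} A \<omega>)))" .
  show int_X: "integrable P X"
    by (rule integrable_const_bound[of _ 1, OF AE_I2 measurable_history[OF t X(1)]]) (simp add: X(2))
  have int_h: "integrable P (\<lambda>\<omega>. h (real (tally {t<..T} A \<omega>)))"
    by (rule integrable_const_bound[of _ 1, OF AE_I2 indep_var_rv2[OF I]]) (simp add: h(2))
  show "expectation (\<lambda>\<omega>. X \<omega> * h (real (tally {t<..T} A \<omega>)))
    = expectation X * expectation (\<lambda>\<omega>. h (real (tally {t<..T} A \<omega>)))"
    by (rule indep_var_lebesgue_integral[OF I int_X int_h])
  show "integrable P (\<lambda>\<omega>. X \<omega> * h (real (tally {t<..T} A \<omega>)))"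
    by (rule indep_var_integrable[OF I int_X int_h])
qed

end

section \<open>Polynomial regret for steep quantile functions\<close>

context multisecretary begin

lemma tally_split:
  assumes t: "t \<in> {1..T}"
  shows "tally {1..<t} A \<omega> + tally {t<..T} A \<omega> \<le> tally {1..T} A \<omega>"
    and "tally {1..T} A \<omega> \<le> tally {1..<t} A \<omega> + 1 + tally {t<..T} A \<omega>"
proof -
  let ?p = "{s\<in>{1..<t}. ability s \<omega> \<in> A}" and ?f = "{s\<in>{t<..T}. ability s \<omega> \<in> A}"
  have "tally {1..<t} A \<omega> + tally {t<..T} A \<omega> = card (?p \<union> ?f)"
    unfolding tally_def by (subst card_Un_disjoint) auto
  also have "\<dots> \<le> tally {1..T} A \<omega>" unfolding tally_def using t by (intro card_mono) auto
  finally show "tally {1..<t} A \<omega> + tally {t<..T} A \<omega> \<le> tally {1..T} A \<omega>" .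
  have "tally {1..T} A \<omega> \<le> card (insert t (?p \<union> ?f))" unfolding tally_def by (intro card_mono) auto
  also have "\<dots> \<le> Suc (card (?p \<union> ?f))" by (rule card_insert_le_m1) auto
  also have "\<dots> \<le> tally {1..<t} A \<omega> + 1 + tally {t<..T} A \<omega>" using card_Un_le[of ?p ?f] by (simp add: tally_def)
  finally show "tally {1..T} A \<omega> \<le> tally {1..<t} A \<omega> + 1 + tally {t<..T} A \<omega>" .
qed

end

text \<open>For \<open>T \<ge> 10000\<close> additive constants up to \<open>1\<close>, from rounding and from the current candidate,
  are absorbed by \<open>0.01 \<surd>T\<close>.\<close>
locale hinge_secretary = multisecretary +
  fixes \<alpha> :: real
  assumes F_hinge: "F = quantile_law (hinge_quantile \<alpha>)"
    and \<alpha>: "0 < \<alpha>" "\<alpha> \<le> 1" and T_large: "T \<ge> 10000"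
begin

text \<open>The unit \<open>\<epsilon>\<close> of quantiles is a small multiple of the fluctuation scale \<open>1/\<surd>T\<close>. The critical
  candidates have abilities in the window \<open>{w\<^sub>1..w\<^sub>2}\<close>, that is, strictly between the two possible
  hindsight prices \<open>0\<close> and \<open>v\<close>; \<open>p\<close> is the probability of an ability of at least \<open>v\<close>.\<close>
definition \<epsilon> :: real where "\<epsilon> = 1 / (100 * sqrt T)"
definition w\<^sub>1 :: real where "w\<^sub>1 = hinge_quantile \<alpha> (1/2 + \<epsilon>)"
definition w\<^sub>2 :: real where "w\<^sub>2 = hinge_quantile \<alpha> (1/2 + 2 * \<epsilon>)"
definition v :: real where "v = hinge_quantile \<alpha> (1/2 + 3 * \<epsilon>)"
definition p :: real where "p = 1/2 - 3 * \<epsilon>"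

abbreviation B :: nat where "B \<equiv> T div 2"

lemma sqrt_T: "sqrt T \<ge> 100"
proof -
  have "sqrt (100 * 100) \<le> sqrt (real T)" using T_large by (intro real_sqrt_le_mono) simp
  thus ?thesis by (simp add: real_sqrt_mult)
qed

lemma \<epsilon>: "0 < \<epsilon>" "\<epsilon> \<le> 1 / 10000" "\<epsilon> * T = sqrt T / 100"
proof -
  show "0 < \<epsilon>" using T_large by (simp add: \<epsilon>_def)
  show "\<epsilon> \<le> 1 / 10000" unfolding \<epsilon>_def using sqrt_T by (intro frac_le) auto
  show "\<epsilon> * T = sqrt T / 100" using T_large by (simp add: \<epsilon>_def field_simps)
qed

lemma measure_sets:
  "measure F {0<..} = 1/2" "measure F {v..} = p" "measure F {w\<^sub>1..w\<^sub>2} = \<epsilon>" "p \<in> {0..1}"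
  using \<epsilon> \<alpha> by (simp_all add: F_hinge measure_hinge_law v_def w\<^sub>1_def w\<^sub>2_def p_def)

text \<open>
  Rejecting a candidate in the window when it should be hired loses at least \<open>w\<^sub>1\<close>; hiring one when only
  those above \<open>v\<close> should be hired loses at least \<open>v - w\<^sub>2\<close>. Both are of order \<open>\<alpha> \<epsilon> powr \<alpha>\<close>; the factor
  \<open>\<alpha>\<close>, which becomes \<open>1 / (1 + \<beta>)\<close> in the final bound, comes from \<open>3 powr \<alpha> - 2 powr \<alpha> \<ge> \<alpha> / 3\<close>.
\<close>
lemma level_gaps:
  "w\<^sub>1 \<ge> \<alpha> / 3 * (T powr (- \<alpha> / 2) / 50)" "v - w\<^sub>2 \<ge> \<alpha> / 3 * (T powr (- \<alpha> / 2) / 50)"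
proof -
  have w1: "w\<^sub>1 = (2 * \<epsilon>) powr \<alpha>" using \<epsilon>(1) by (simp add: w\<^sub>1_def hinge_quantile_def max_def)
  have "v - w\<^sub>2 = (6 * \<epsilon>) powr \<alpha> - (4 * \<epsilon>) powr \<alpha>"
    using \<epsilon>(1) by (simp add: v_def w\<^sub>2_def hinge_quantile_def max_def algebra_simps)
  also have "\<dots> = (2 * \<epsilon>) powr \<alpha> * (3 powr \<alpha> - 2 powr \<alpha>)"
    using \<epsilon>(1) by (simp add: right_diff_distrib flip: powr_mult)
  finally have vw: "v - w\<^sub>2 = (2 * \<epsilon>) powr \<alpha> * (3 powr \<alpha> - 2 powr \<alpha>)" .
  \<comment> \<open>The ratio \<open>3/2\<close> is between the quantile offsets \<open>3\<epsilon>\<close> of \<open>v\<close> and \<open>2\<epsilon>\<close> of \<open>w\<^sub>2\<close>.\<close>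
  have "\<alpha> / 3 \<le> \<alpha> * ln (3 / 2)" using ln_le_minus_one[of "2 / 3"] \<alpha>(1) by (simp add: ln_div)
  also have "\<dots> \<le> exp (\<alpha> * ln (3 / 2)) - 1" using exp_ge_add_one_self[of "\<alpha> * ln (3 / 2)"] by linarith
  also have "\<dots> = (3 / 2) powr \<alpha> - 1" by (simp add: powr_def)
  also have "\<dots> \<le> 2 powr \<alpha> * ((3 / 2) powr \<alpha> - 1)"
    using ge_one_powr_ge_zero[of 2 \<alpha>] ge_one_powr_ge_zero[of "3/2" \<alpha>] \<alpha>(1) 
    using mult_right_mono[of 1 "2 powr \<alpha>" "(3 / 2) powr \<alpha> - 1"] by simp
  also have "\<dots> = 3 powr \<alpha> - 2 powr \<alpha>" by (simp add: right_diff_distrib flip: powr_mult)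
  finally have ratio: "\<alpha> / 3 \<le> 3 powr \<alpha> - 2 powr \<alpha>" .
  have "(2 * \<epsilon>) powr \<alpha> = (1 / 50) powr \<alpha> * sqrt T powr (- \<alpha>)"
    using sqrt_T by (simp add: \<epsilon>_def powr_mult powr_divide powr_minus field_simps)
  also have "sqrt T powr (- \<alpha>) = T powr (- \<alpha> / 2)"
    by (simp add: powr_half_sqrt[symmetric] powr_powr)
  finally have "(2 * \<epsilon>) powr \<alpha> \<ge> (1 / 50) * T powr (- \<alpha> / 2)"
    using mult_right_mono[OF powr_mono'[of \<alpha> 1 "1/50"], of "T powr (- \<alpha> / 2)"] \<alpha> by simp
  hence base: "T powr (- \<alpha> / 2) / 50 \<le> (2 * \<epsilon>) powr \<alpha>" by simp
  show "w\<^sub>1 \<ge> \<alpha> / 3 * (T powr (- \<alpha> / 2) / 50)"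
    unfolding w1 using mult_mono[of "\<alpha> / 3" 1, OF _ base] \<alpha> by simp
  show "v - w\<^sub>2 \<ge> \<alpha> / 3 * (T powr (- \<alpha> / 2) / 50)"
    unfolding vw using mult_mono[OF ratio base] \<alpha> ratio by (simp add: mult.commute)
qed

text \<open>The past leaves the outcome open: the tallies above \<open>0\<close> and above \<open>v\<close> are near their means.\<close>
definition balanced :: "nat \<Rightarrow> scenario \<Rightarrow> bool" where
  "balanced t \<omega> \<longleftrightarrow> \<bar>real (tally {1..<t} {0<..} \<omega>) - real (t - 1) * (1/2)\<bar> < sqrt T / 20 \<and>
     \<bar>real (tally {1..<t} {v..} \<omega>) - real (t - 1) * p\<bar> < sqrt T / 20"

text \<open>As functions of the future tallies above \<open>0\<close> and above \<open>v\<close>: the indicators that the future falls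
  short of, or exceeds, its mean by a quarter of a standard deviation. The factors \<open>- 1\<close> and \<open>1\<close> are the
  directions in \<open>binomial_anticoncentration\<close>.\<close>
definition scarce :: "nat \<Rightarrow> real \<Rightarrow> real" where
  "scarce t x = of_bool (sqrt (real (T - t) * (1/2 * (1 - 1/2))) / 4 \<le> (- 1) * (x - real (T - t) * (1/2)))"
definition plenty :: "nat \<Rightarrow> real \<Rightarrow> real" where
  "plenty t x = of_bool (sqrt (real (T - t) * (p * (1 - p))) / 4 \<le> 1 * (x - real (T - t) * p))"

text \<open>
  Almost all periods are still to come, and the two success probabilities are close to \<open>1/2\<close>, so the
  standard deviations stay close to \<open>\<surd>T / 2\<close>.
\<close>
lemma future_spread:
  assumes t: "t \<le> T div 400"
  shows "sqrt (real (T - t) * (1/2 * (1 - 1/2))) \<ge> 48/100 * sqrt T"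
    and "sqrt (real (T - t) * (p * (1 - p))) \<ge> 48/100 * sqrt T"
proof -
  have n: "real (T - t) \<ge> 399/400 * real T" using t by linarith
  have "9 * (\<epsilon> * \<epsilon>) \<le> 9 * ((1 / 10000) * (1 / 10000))" using \<epsilon> by (intro mult_left_mono mult_mono) auto
  hence v: "p * (1 - p) \<ge> 24/100" by (simp add: p_def algebra_simps)
  have *: "sqrt (real (T - t) * x) \<ge> 48/100 * sqrt T" if "x \<ge> 24/100" for x
  proof -
    have "(48/100)^2 * real T \<le> 399/400 * real T * (24/100)" by (simp add: power2_eq_square)
    also have "\<dots> \<le> real (T - t) * x" using n that by (intro mult_mono) auto
    finally have "sqrt ((48/100)^2 * real T) \<le> sqrt (real (T - t) * x)" by (rule real_sqrt_le_mono)
    thus ?thesis by (simp add: real_sqrt_mult)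
  qed
  show "sqrt (real (T - t) * (1/2 * (1 - 1/2))) \<ge> 48/100 * sqrt T" by (rule *) simp
  show "sqrt (real (T - t) * (p * (1 - p))) \<ge> 48/100 * sqrt T" using v by (rule *)
qed

lemma future_probabilities:
  assumes t: "t \<le> T div 400"
  shows "expectation (\<lambda>\<omega>. scarce t (real (tally {t<..T} {0<..} \<omega>))) \<ge> 1 / 64"
    and "expectation (\<lambda>\<omega>. plenty t (real (tally {t<..T} {v..} \<omega>))) \<ge> 1 / 64"
proof -
  have J: "{t<..T} \<subseteq> {1..T}" by auto
  have "1 / 64 \<le> measure_pmf.expectation (binomial_pmf (T - t) (1/2)) (\<lambda>k. scarce t (real k))"
    unfolding scarce_def using future_spread(1)[OF t] sqrt_T
    by (intro binomial_anticoncentration) auto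
  thus "expectation (\<lambda>\<omega>. scarce t (real (tally {t<..T} {0<..} \<omega>))) \<ge> 1 / 64"
    using expectation_tally[OF _ J, of "{0<..}" "\<lambda>k. scarce t (real k)"] by (simp add: measure_sets)
  have "1 / 64 \<le> measure_pmf.expectation (binomial_pmf (T - t) p) (\<lambda>k. plenty t (real k))"
    unfolding plenty_def using future_spread(2)[OF t] sqrt_T measure_sets(4)
    by (intro binomial_anticoncentration) auto
  thus "expectation (\<lambda>\<omega>. plenty t (real (tally {t<..T} {v..} \<omega>))) \<ge> 1 / 64"
    using expectation_tally[OF _ J, of "{v..}" "\<lambda>k. plenty t (real k)"] by (simp add: measure_sets)
qed

lemma balanced_measurable:
  assumes "1 \<le> t"
  shows "(\<lambda>\<omega>. of_bool (balanced t \<omega>) :: real) \<in> borel_measurable (history F T (t - 1))"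
proof -
  have J: "{1..<t} \<subseteq> {1..t - 1}" by auto
  define x y where "x = (\<lambda>\<omega>. real (tally {1..<t} {0<..} \<omega>))" and "y = (\<lambda>\<omega>. real (tally {1..<t} {v..} \<omega>))"
  have [measurable]: "x \<in> borel_measurable (history F T (t - 1))" "y \<in> borel_measurable (history F T (t - 1))"
    unfolding x_def y_def by (intro tally_history J; simp)+
  have "balanced t = (\<lambda>\<omega>. \<bar>x \<omega> - real (t - 1) * (1/2)\<bar> < sqrt T / 20 \<and> \<bar>y \<omega> - real (t - 1) * p\<bar> < sqrt T / 20)"
    by (simp add: fun_eq_iff balanced_def x_def y_def)
  hence "(\<lambda>\<omega>. of_bool (balanced t \<omega>)) = (\<lambda>\<omega>. if \<bar>x \<omega> - real (t - 1) * (1/2)\<bar> < sqrt T / 20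
      \<and> \<bar>y \<omega> - real (t - 1) * p\<bar> < sqrt T / 20 then 1 else 0 :: real)"
    by (simp add: fun_eq_iff)
  also have "\<dots> \<in> borel_measurable (history F T (t - 1))" by measurable
  finally show ?thesis .
qed

text \<open>
  At most \<open>T/400\<close> periods have passed, so by Chebyshev each of the two tallies deviates by \<open>\<surd>T/20\<close>
  with probability at most \<open>(T/400) / 4 / (T/400) = 1/4\<close>.
\<close>
lemma balanced_probability:
  assumes t: "1 \<le> t" "t \<le> T div 400"
  shows "expectation (\<lambda>\<omega>. of_bool (balanced t \<omega>)) \<ge> (1 / 2 :: real)"
proof -
  have J: "{1..<t} \<subseteq> {1..T}" using t by auto
  have K: "sqrt T / 20 > 0" using T_large by simp
  let ?d = "\<lambda>A q \<omega>. of_bool (\<bar>real (tally {1..<t} A \<omega>) - real (t - 1) * q\<bar> \<ge> sqrt T / 20) :: real"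
  have m: "(\<lambda>\<omega>. real (tally {1..<t} A \<omega>)) \<in> borel_measurable P" if "A \<in> sets borel" for A
    using t by (intro measurable_history[OF _ tally_history[OF that, of _ "t - 1"]]) auto
  have dev: "expectation (?d A (measure F A)) \<le> 1 / 4" and int: "integrable P (?d A q)"
    if A: "A \<in> sets borel" and q: "measure F A \<in> {0..1}" for A q
  proof -
    have "expectation (?d A (measure F A)) \<le> real (t - 1) / 4 / (sqrt T / 20)\<^sup>2"
      using binomial_chebyshev[OF q K, of "t - 1"]
        expectation_tally[OF A J, of "\<lambda>k. of_bool (\<bar>real k - real (t - 1) * measure F A\<bar> \<ge> sqrt T / 20)"]
      by simp
    also have "\<dots> = 100 * real (t - 1) / T" by (simp add: power_divide)
    also have "\<dots> \<le> 1 / 4"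
      using t T_large by (simp add: field_simps)
    finally show "expectation (?d A (measure F A)) \<le> 1 / 4" .
    show "integrable P (?d A q)"
      using m[OF A] by (intro integrable_const_bound[of _ 1]) auto
  qed
  define d1 d2 where "d1 = ?d {0<..} (1/2)" and "d2 = ?d {v..} p"
  have d: "expectation d1 \<le> 1 / 4" "expectation d2 \<le> 1 / 4" "integrable P d1" "integrable P d2"
    unfolding d1_def d2_def
    using dev[of "{0<..}"] dev[of "{v..}"] int[of "{0<..}" "1/2"] int[of "{v..}" p] measure_sets by auto
  have d_sum: "integrable P (\<lambda>\<omega>. d1 \<omega> + d2 \<omega>)" using d(3,4) by (rule Bochner_Integration.integrable_add)
  have "expectation (\<lambda>\<omega>. 1 - (d1 \<omega> + d2 \<omega>)) = expectation (\<lambda>\<omega>. 1) - expectation (\<lambda>\<omega>. d1 \<omega> + d2 \<omega>)"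
    by (rule Bochner_Integration.integral_diff[OF _ d_sum]) simp
  also have "expectation (\<lambda>\<omega>. d1 \<omega> + d2 \<omega>) = expectation d1 + expectation d2"
    using d(3,4) by (rule Bochner_Integration.integral_add)
  finally have "1 - (1 / 4 + 1 / 4) \<le> expectation (\<lambda>\<omega>. 1 - (d1 \<omega> + d2 \<omega>))"
    using d(1,2) by (simp only: prob_space lebesgue_integral_const scaleR_one)
  also have "\<dots> \<le> expectation (\<lambda>\<omega>. of_bool (balanced t \<omega>))"
  proof (rule integral_mono)
    show "integrable P (\<lambda>\<omega>. of_bool (balanced t \<omega>) :: real)"
      using t measurable_history[OF _ balanced_measurable[OF t(1)]]
      by (intro integrable_const_bound[of _ 1]) auto
    show "integrable P (\<lambda>\<omega>. 1 - (d1 \<omega> + d2 \<omega>))"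
      by (rule Bochner_Integration.integrable_diff[OF _ d_sum]) simp
  qed (auto simp: balanced_def not_le d1_def d2_def)
  finally show ?thesis by simp
qed

text \<open>
  The future shortfall of at least \<open>0.12 \<surd>T\<close> outweighs the surplus of at most \<open>0.05 \<surd>T\<close> from the past.
\<close>
lemma balanced_scarce:
  assumes t: "1 \<le> t" "t \<le> T div 400" and "balanced t \<omega>" "scarce t (real (tally {t<..T} {0<..} \<omega>)) \<noteq> 0"
  shows "card {s\<in>{1..T}. ability s \<omega> > 0} \<le> B"
proof -
  have "real (tally {1..<t} {0<..} \<omega>) < real (t - 1) / 2 + sqrt T / 20"
    using assms(3) unfolding balanced_def by linarith
  moreover have "real (tally {t<..T} {0<..} \<omega>) \<le> real (T - t) / 2 - 48/100 * sqrt T / 4"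
    using assms(4) future_spread(1)[OF t(2)] by (simp add: scarce_def)
  moreover have "tally {1..T} {0<..} \<omega> \<le> tally {1..<t} {0<..} \<omega> + 1 + tally {t<..T} {0<..} \<omega>"
    using t by (intro tally_split) auto
  hence "real (tally {1..T} {0<..} \<omega>) \<le> real (tally {1..<t} {0<..} \<omega>) + 1 + real (tally {t<..T} {0<..} \<omega>)"
    by linarith
  moreover have "real (t - 1) + real (T - t) = real T - 1" using t by linarith
  ultimately have "real (tally {1..T} {0<..} \<omega>) \<le> real T / 2 - 1 / 2" using sqrt_T by linarith
  moreover have "real T / 2 - 1 / 2 \<le> real B" by linarith
  ultimately show ?thesis by (simp add: tally_def)
qed

text \<open>
  The future surplus of at least \<open>0.12 \<surd>T\<close> has to cover a past deficit of \<open>0.05 \<surd>T\<close> and the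
  \<open>3 \<epsilon> T = 0.03 \<surd>T\<close> candidates by which \<open>T p\<close> falls short of \<open>T/2\<close>.
\<close>
lemma balanced_plenty:
  assumes t: "1 \<le> t" "t \<le> T div 400" and "balanced t \<omega>" "plenty t (real (tally {t<..T} {v..} \<omega>)) \<noteq> 0"
  shows "B \<le> card {s\<in>{1..T}. ability s \<omega> \<ge> v}"
proof -
  have "real (tally {1..<t} {v..} \<omega>) > real (t - 1) * p - sqrt T / 20"
    using assms(3) unfolding balanced_def by linarith
  moreover have "real (tally {t<..T} {v..} \<omega>) \<ge> real (T - t) * p + 48/100 * sqrt T / 4"
    using assms(4) future_spread(2)[OF t(2)] by (simp add: plenty_def)
  moreover have "tally {1..<t} {v..} \<omega> + tally {t<..T} {v..} \<omega> \<le> tally {1..T} {v..} \<omega>"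
    using t by (intro tally_split) auto
  hence "real (tally {1..<t} {v..} \<omega>) + real (tally {t<..T} {v..} \<omega>) \<le> real (tally {1..T} {v..} \<omega>)"
    by linarith
  moreover have "real (t - 1) * p + real (T - t) * p \<ge> real T / 2 - 1 / 2 - 3 * sqrt T / 100"
  proof -
    have "real (t - 1) * p + real (T - t) * p = (real T - 1) * p"
      unfolding distrib_right[symmetric] using t by (intro arg_cong[of _ _ "\<lambda>x. x * p"]) linarith
    also have "\<dots> = real T / 2 - 1 / 2 - 3 * (\<epsilon> * T) + 3 * \<epsilon>" by (simp add: p_def field_simps)
    finally show ?thesis using \<epsilon> by simp
  qed
  ultimately have "real (tally {1..T} {v..} \<omega>) \<ge> real T / 2" using sqrt_T by linarith
  moreover have "real T / 2 \<ge> real B" by linarith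
  ultimately have "real B \<le> real (tally {1..T} {v..} \<omega>)" by linarith
  thus ?thesis by (simp add: tally_def)
qed

lemma balanced_window_expectation:
  assumes t: "1 \<le> t" "t \<le> T div 400"
  shows "expectation (\<lambda>\<omega>. of_bool (balanced t \<omega>) * indicator {w\<^sub>1..w\<^sub>2} (ability t \<omega>)) \<ge> \<epsilon> / 2"
proof -
  have tT: "t \<in> {t - 1<..T}" "t \<in> {1..T}" using t by auto
  have ind: "indep_var borel (id \<circ> (\<lambda>\<omega>. of_bool (balanced t \<omega>) :: real)) borel (indicator {w\<^sub>1..w\<^sub>2} \<circ> ability t)"
    by (rule indep_var_compose[OF indep_history_ability[OF balanced_measurable[OF t(1)] tT(1)]]) auto
  have "expectation (\<lambda>\<omega>. of_bool (balanced t \<omega>) * indicator {w\<^sub>1..w\<^sub>2} (ability t \<omega>))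
      = expectation (\<lambda>\<omega>. of_bool (balanced t \<omega>)) * (expectation (\<lambda>\<omega>. indicator {w\<^sub>1..w\<^sub>2} (ability t \<omega>)) :: real)"
    using indep_var_lebesgue_integral[OF ind
        integrable_const_bound[of _ 1, OF AE_I2 indep_var_rv1[OF ind]]
        integrable_const_bound[of _ 1, OF AE_I2 indep_var_rv2[OF ind]]]
    by (simp add: comp_def)
  also have "expectation (\<lambda>\<omega>. indicator {w\<^sub>1..w\<^sub>2} (ability t \<omega>)) = integral\<^sup>L (distr P borel (ability t)) (indicator {w\<^sub>1..w\<^sub>2} :: real \<Rightarrow> real)"
    using tT by (subst integral_distr) auto
  also have "\<dots> = \<epsilon>" using tT by (simp add: distr_ability measure_sets)
  finally show ?thesis
    using mult_right_mono[OF balanced_probability[OF t], of \<epsilon>] \<epsilon>(1) by simp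
qed

text \<open>\<open>missed\<close> and \<open>wasted\<close> are indicators of a wrong decision on a critical candidate: a
  rejection followed by a poor future, an acceptance followed by a rich one.\<close>
definition window :: "nat \<Rightarrow> scenario \<Rightarrow> real" where
  "window t \<omega> = of_bool (balanced t \<omega>) * indicator {w\<^sub>1..w\<^sub>2} (ability t \<omega>)"
definition missed :: "(nat \<Rightarrow> scenario \<Rightarrow> nat) \<Rightarrow> nat \<Rightarrow> scenario \<Rightarrow> real" where
  "missed a t \<omega> = window t \<omega> * (1 - real (a t \<omega>)) * scarce t (real (tally {t<..T} {0<..} \<omega>))"
definition wasted :: "(nat \<Rightarrow> scenario \<Rightarrow> nat) \<Rightarrow> nat \<Rightarrow> scenario \<Rightarrow> real" where
  "wasted a t \<omega> = window t \<omega> * real (a t \<omega>) * plenty t (real (tally {t<..T} {v..} \<omega>))"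

text \<open>
  Whichever decision is taken, one of the two adverse futures punishes it. Both have probability at
  least \<open>1/64\<close> independently of the decision, so the weights \<open>1 - a\<^sub>t\<close> and \<open>a\<^sub>t\<close> add up and the
  policy drops out.
\<close>
lemma window_step:
  assumes a: "a \<in> policies F B T" and t: "1 \<le> t" "t \<le> T div 400"
  shows "integrable P (missed a t)" "integrable P (wasted a t)"
    "expectation (missed a t) + expectation (wasted a t) \<ge> \<epsilon> / 128"
proof -
  have tT: "t \<in> {1..T}" "t \<le> T" "t \<in> {1..t}" using t by auto
  have [measurable]: "window t \<in> borel_measurable (history F T t)" "(\<lambda>\<omega>. real (a t \<omega>)) \<in> borel_measurable (history F T t)"
    unfolding window_def[abs_def]
    using history_mono[OF _ balanced_measurable[OF t(1)], of t] ability_history[OF tT(3)] policy_history[OF a tT(1)]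
    by auto
  have W: "0 \<le> window t \<omega>" "window t \<omega> \<le> 1" for \<omega> by (auto simp: window_def indicator_def)
  have aw: "real (a t \<omega>) = 0 \<or> real (a t \<omega>) = 1" if "\<omega> \<in> space P" for \<omega>
    using policy_values[OF a tT(1) that] by auto
  have "\<bar>window t \<omega> * (1 - real (a t \<omega>))\<bar> \<le> 1" "\<bar>window t \<omega> * real (a t \<omega>)\<bar> \<le> 1" if "\<omega> \<in> space P" for \<omega>
    using aw[OF that] W[of \<omega>] by auto
  hence bX: "\<forall>\<omega>\<in>space P. \<bar>window t \<omega> * (1 - real (a t \<omega>))\<bar> \<le> 1"
    and bY: "\<forall>\<omega>\<in>space P. \<bar>window t \<omega> * real (a t \<omega>)\<bar> \<le> 1" by blast+
  have "scarce t \<in> borel_measurable borel" unfolding scarce_def[abs_def] of_bool_def by measurable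
  moreover have "\<bar>scarce t x\<bar> \<le> 1" for x by (simp add: scarce_def)
  ultimately have s: "scarce t \<in> borel_measurable borel" "\<And>x. \<bar>scarce t x\<bar> \<le> 1" .
  have "plenty t \<in> borel_measurable borel" unfolding plenty_def[abs_def] of_bool_def by measurable
  moreover have "\<bar>plenty t x\<bar> \<le> 1" for x by (simp add: plenty_def)
  ultimately have p: "plenty t \<in> borel_measurable borel" "\<And>x. \<bar>plenty t x\<bar> \<le> 1" .
  have mX: "(\<lambda>\<omega>. window t \<omega> * (1 - real (a t \<omega>))) \<in> borel_measurable (history F T t)"
    and mY: "(\<lambda>\<omega>. window t \<omega> * real (a t \<omega>)) \<in> borel_measurable (history F T t)"
    by measurable
  have sets: "{0<..} \<in> sets (borel :: real measure)" "{v..} \<in> sets (borel :: real measure)" by auto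
  note eX = expectation_history_future_tally[OF mX bX tT(2) sets(1) s]
  note eY = expectation_history_future_tally[OF mY bY tT(2) sets(2) p]
  show "integrable P (missed a t)" "integrable P (wasted a t)"
    unfolding missed_def[abs_def] wasted_def[abs_def] using eX(3) eY(3) .
  let ?x = "expectation (\<lambda>\<omega>. window t \<omega> * (1 - real (a t \<omega>)))" and ?y = "expectation (\<lambda>\<omega>. window t \<omega> * real (a t \<omega>))"
  have "0 \<le> window t \<omega> * (1 - real (a t \<omega>))" "0 \<le> window t \<omega> * real (a t \<omega>)" if "\<omega> \<in> space P" for \<omega>
    using aw[OF that] W(1)[of \<omega>] by auto
  hence "?x \<ge> 0" "?y \<ge> 0" by (auto intro!: integral_nonneg_AE AE_I2)
  hence "?x * (1 / 64) + ?y * (1 / 64) \<le> expectation (missed a t) + expectation (wasted a t)"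
    unfolding missed_def[abs_def] wasted_def[abs_def] eX(1) eY(1)
    by (intro add_mono mult_left_mono future_probabilities[OF t(2)])
  moreover have "?x + ?y = expectation (window t)"
    unfolding Bochner_Integration.integral_add[OF eX(2) eY(2), symmetric]
    by (simp add: algebra_simps)
  moreover have "expectation (window t) \<ge> \<epsilon> / 2" unfolding window_def[abs_def] by (rule balanced_window_expectation[OF t])
  ultimately show "expectation (missed a t) + expectation (wasted a t) \<ge> \<epsilon> / 128" by linarith
qed

lemma hinge_regret:
  assumes a: "a \<in> policies F B T"
  shows "regret F B T a \<ge> 1 / 10^10 * \<alpha> * T powr (1/2 - \<alpha> / 2)"
proof -
  define m where "m = \<alpha> / 3 * (T powr (- \<alpha> / 2) / 50)"
  let ?I = "{1..T div 400}"
  have m: "0 \<le> m" "m \<le> w\<^sub>1" "m \<le> v - w\<^sub>2" using level_gaps \<alpha> by (auto simp: m_def)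
  let ?gap = "\<lambda>\<omega>. best B \<omega> - (\<Sum>t=1..T. ability t \<omega> * real (a t \<omega>))"
  note step = window_step[OF a]
  have I_sub: "?I \<subseteq> {1..T}" by auto
  \<comment> \<open>The regret dominates both sums of losses, hence half of their total.\<close>
  have "AE \<omega> in P. (\<Sum>t\<in>?I. m * missed a t \<omega>) + (\<Sum>t\<in>?I. m * wasted a t \<omega>) \<le> 2 * ?gap \<omega>"
  proof -
    have "AE \<omega> in P. (\<Sum>t=1..T. a t \<omega>) \<le> B" using a by (simp add: policies_def)
    with AE_ability AE_space show ?thesis
    proof eventually_elim
      case (elim \<omega>)
      have aw: "a t \<omega> = 0 \<or> a t \<omega> = 1" if "t \<in> {1..T}" for t
        using policy_values[OF a that elim(2)] .
      have gap0: "0 \<le> ?gap \<omega>" using gap_nonneg[of "\<lambda>t. a t \<omega>" B \<omega>] aw elim(3) by auto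
      \<comment> \<open>If the positive candidates do not fit, no period counts as missed.\<close>
      have "(\<Sum>t\<in>?I. m * missed a t \<omega>) \<le> ?gap \<omega>"
      proof (cases "card {s\<in>{1..T}. ability s \<omega> > 0} \<le> B")
        case True
        have "(\<Sum>t\<in>?I. m * missed a t \<omega>) \<le> (\<Sum>t\<in>?I. ability t \<omega> * (1 - real (a t \<omega>)))"
        proof (rule sum_mono)
          fix t assume "t \<in> ?I"
          hence t: "t \<in> {1..T}" by auto
          show "m * missed a t \<omega> \<le> ability t \<omega> * (1 - real (a t \<omega>))"
            using aw[OF t] elim(1) t m by (auto simp: missed_def window_def indicator_def scarce_def)
        qed
        also have "\<dots> \<le> ?gap \<omega>"
          using elim(1) aw True I_sub by (intro gap_when_positive_fit) auto
        finally show ?thesis .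
      next
        case False
        have "missed a t \<omega> = 0" if "t \<in> ?I" for t
          using balanced_scarce[of t \<omega>] that False by (auto simp: missed_def window_def)
        thus ?thesis using gap0 by simp
      qed
      \<comment> \<open>If fewer than \<open>B\<close> candidates reach \<open>v\<close>, no period counts as wasted.\<close>
      moreover have "(\<Sum>t\<in>?I. m * wasted a t \<omega>) \<le> ?gap \<omega>"
      proof (cases "B \<le> card {s\<in>{1..T}. ability s \<omega> \<ge> v}")
        case True
        have "(\<Sum>t\<in>?I. m * wasted a t \<omega>) \<le> (\<Sum>t\<in>?I. max 0 (v - ability t \<omega>) * real (a t \<omega>))"
        proof (rule sum_mono)
          fix t assume "t \<in> ?I"
          hence t: "t \<in> {1..T}" by auto
          show "m * wasted a t \<omega> \<le> max 0 (v - ability t \<omega>) * real (a t \<omega>)"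
            using aw[OF t] m by (auto simp: wasted_def window_def indicator_def plenty_def)
        qed
        also have "\<dots> \<le> ?gap \<omega>"
          using elim(3) aw True I_sub by (intro gap_when_level_full) auto
        finally show ?thesis .
      next
        case False
        have "wasted a t \<omega> = 0" if "t \<in> ?I" for t
          using balanced_plenty[of t \<omega>] that False by (auto simp: wasted_def window_def)
        thus ?thesis using gap0 by simp
      qed
      ultimately show ?case unfolding mult_2 by (rule add_mono)
    qed
  qed
  note gap_bound = this
  have int: "integrable P (\<lambda>\<omega>. \<Sum>t\<in>?I. m * missed a t \<omega>)" "integrable P (\<lambda>\<omega>. \<Sum>t\<in>?I. m * wasted a t \<omega>)"
    using step(1,2) by (intro Bochner_Integration.integrable_sum integrable_mult_right; simp)+
  from gap_bound have "expectation (\<lambda>\<omega>. (\<Sum>t\<in>?I. m * missed a t \<omega>) + (\<Sum>t\<in>?I. m * wasted a t \<omega>)) \<le> expectation (\<lambda>\<omega>. 2 * ?gap \<omega>)"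
  proof (rule integral_mono_AE[rotated 2])
    show "integrable P (\<lambda>\<omega>. (\<Sum>t\<in>?I. m * missed a t \<omega>) + (\<Sum>t\<in>?I. m * wasted a t \<omega>))"
      using int by (rule Bochner_Integration.integrable_add)
    show "integrable P (\<lambda>\<omega>. 2 * ?gap \<omega>)"
      by (intro integrable_mult_right Bochner_Integration.integrable_diff integrable_best integrable_collected[OF a])
  qed
  also have "expectation (\<lambda>\<omega>. 2 * ?gap \<omega>) = 2 * regret F B T a" by (simp only: regret_eq[OF a] integral_mult_right_zero)
  also have "expectation (\<lambda>\<omega>. (\<Sum>t\<in>?I. m * missed a t \<omega>) + (\<Sum>t\<in>?I. m * wasted a t \<omega>))
      = (\<Sum>t\<in>?I. m * (expectation (missed a t) + expectation (wasted a t)))"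
  proof -
    have "expectation (\<lambda>\<omega>. \<Sum>t\<in>?I. m * missed a t \<omega>) = (\<Sum>t\<in>?I. m * expectation (missed a t))"
      "expectation (\<lambda>\<omega>. \<Sum>t\<in>?I. m * wasted a t \<omega>) = (\<Sum>t\<in>?I. m * expectation (wasted a t))"
      using step(1,2) by (subst Bochner_Integration.integral_sum; simp)+
    thus ?thesis by (simp only: Bochner_Integration.integral_add[OF int] sum.distrib distrib_left)
  qed
  finally have "(\<Sum>t\<in>?I. m * (expectation (missed a t) + expectation (wasted a t))) \<le> 2 * regret F B T a" .
  moreover have "(\<Sum>t\<in>?I. m * (\<epsilon> / 128)) \<le> (\<Sum>t\<in>?I. m * (expectation (missed a t) + expectation (wasted a t)))"
    using step(3) m by (intro sum_mono mult_left_mono) auto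
  ultimately have "real (T div 400) * (m * (\<epsilon> / 128)) \<le> 2 * regret F B T a" by simp
  moreover have "real T / 800 * (m * (\<epsilon> / 128)) \<le> real (T div 400) * (m * (\<epsilon> / 128))"
    using T_large m \<epsilon> by (intro mult_right_mono) (linarith | simp)+
  moreover have "real T / 800 * (m * (\<epsilon> / 128)) = sqrt T / 100 * m / 102400"
    unfolding \<epsilon>(3)[symmetric] by simp
  moreover have "sqrt T * m = \<alpha> / 150 * T powr (1/2 - \<alpha> / 2)"
  proof -
    have "sqrt T * T powr (- \<alpha> / 2) = T powr (1/2 + - \<alpha> / 2)"
      unfolding powr_add by (simp add: powr_half_sqrt)
    thus ?thesis by (simp add: m_def)
  qed
  \<comment> \<open>The constant collects \<open>1/800\<close> from the periods, \<open>1/128\<close> from \<open>window_step\<close>, \<open>1/100\<close> from \<open>\<epsilon>\<close> and \<open>1/150\<close> from \<open>m\<close>.\<close>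
  ultimately have "\<alpha> / 150 * T powr (1/2 - \<alpha> / 2) / 10240000 \<le> 2 * regret F B T a" by simp
  moreover have "\<alpha> * T powr (1/2 - \<alpha> / 2) \<ge> 0" using \<alpha> by simp
  ultimately show ?thesis by (simp add: field_simps)
qed

end

section \<open>The uniform law and sums of largest abilities\<close>

text \<open>
  The antiderivative needed to integrate \<open>(\<theta> - c)\<^sup>+\<close> against the uniform law without
  distinguishing the position of \<open>c\<close>.
\<close>
lemma has_derivative_half_square_pospart:
  "((\<lambda>x::real. (max 0 (x - c))\<^sup>2 / 2) has_real_derivative max 0 (x - c)) (at x)"
proof -
  have base: "((\<lambda>x::real. (max 0 x)\<^sup>2 / 2) has_real_derivative max 0 y) (at y)" for y
  proof -
    consider "y > 0" | "y < 0" | "y = 0" by linarith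
    thus ?thesis
    proof cases
      case 1
      have "((\<lambda>x::real. x\<^sup>2 / 2) has_real_derivative y) (at y)" by (auto intro!: derivative_eq_intros)
      hence "((\<lambda>x::real. (max 0 x)\<^sup>2 / 2) has_real_derivative y) (at y)"
        by (rule has_field_derivative_transform_within_open[of _ _ _ "{0<..}"]) (use 1 in auto)
      thus ?thesis using 1 by simp
    next
      case 2
      have "((\<lambda>x::real. 0) has_real_derivative 0) (at y)" by simp
      hence "((\<lambda>x::real. (max 0 x)\<^sup>2 / 2) has_real_derivative 0) (at y)"
        by (rule has_field_derivative_transform_within_open[of _ _ _ "{..<0}"]) (use 2 in auto)
      thus ?thesis using 2 by simp
    next
      case 3
      have "((\<lambda>h::real. max 0 h / 2) \<longlongrightarrow> max 0 0 / 2) (at 0)" by (intro tendsto_intros) simp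
      moreover have "\<forall>\<^sub>F h in at (0::real). max 0 h / 2 = ((max 0 (0 + h))\<^sup>2 / 2 - (max 0 0)\<^sup>2 / 2) / h"
        by (auto simp: eventually_at_filter power2_eq_square max_def)
      ultimately have "((\<lambda>h::real. ((max 0 (0 + h))\<^sup>2 / 2 - (max 0 0)\<^sup>2 / 2) / h) \<longlongrightarrow> 0) (at 0)"
        using Lim_transform_eventually by fastforce
      thus ?thesis using 3 by (simp add: DERIV_def)
    qed
  qed
  have "((\<lambda>x. x - c) has_real_derivative 1) (at x)" by (auto intro!: derivative_eq_intros)
  from DERIV_chain2[OF base this] show ?thesis by simp
qed

lemma ex_top_subset:
  fixes x :: "'a \<Rightarrow> real"
  assumes "finite J"
  shows "\<exists>S\<subseteq>J. card S = min B (card J) \<and> (\<forall>i\<in>S. \<forall>j\<in>J - S. x j \<le> x i)"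
proof (induction B)
  case 0 show ?case by (intro exI[of _ "{}"]) auto
next
  case (Suc B)
  then obtain S where S: "S \<subseteq> J" "card S = min B (card J)" "\<forall>i\<in>S. \<forall>j\<in>J - S. x j \<le> x i" by blast
  have fin: "finite S" using S(1) assms by (rule finite_subset)
  show ?case
  proof (cases "J - S = {}")
    case True
    hence "S = J" using S(1) by blast
    thus ?thesis using S by (intro exI[of _ S]) auto
  next
    case False
    define m where "m = Max (x ` (J - S))"
    have "m \<in> x ` (J - S)" unfolding m_def using assms False by (intro Max_in) auto
    then obtain j where j: "j \<in> J - S" "x j = m" by auto
    have le: "x i \<le> m" if "i \<in> J - S" for i
      unfolding m_def using assms that by (intro Max_ge) auto
    have "card S < card J" using j S(1) assms by (intro psubset_card_mono) auto
    hence "card (insert j S) = min (Suc B) (card J)" using S(2) j fin by auto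
    thus ?thesis using S j le by (intro exI[of _ "insert j S"]) auto
  qed
qed

text \<open>
  Either the top set lies entirely above \<open>c\<close>, or one of its members does not, and then nothing outside it
  exceeds \<open>c\<close>.
\<close>
lemma min_card_above_le:
  fixes x :: "'a \<Rightarrow> real"
  assumes "finite J" "S \<subseteq> J" "card S = min B (card J)" "\<forall>i\<in>S. \<forall>j\<in>J - S. x j \<le> x i"
  shows "min B (card {j\<in>J. x j > c}) \<le> card {i\<in>S. x i > c}"
proof (cases "\<forall>i\<in>S. x i > c")
  case True
  hence "{i\<in>S. x i > c} = S" by auto
  moreover have "card {j\<in>J. x j > c} \<le> card J" using assms(1) by (intro card_mono) auto
  ultimately show ?thesis using assms(3) by auto
next
  case False
  then obtain i where "i \<in> S" "x i \<le> c" by (auto simp: not_less)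
  hence "x j \<le> c" if "j \<in> J - S" for j using assms(4) that order_trans by blast
  hence "{j\<in>J. x j > c} \<subseteq> {i\<in>S. x i > c}" by (auto simp: not_less[symmetric])
  moreover have "finite {i\<in>S. x i > c}" using finite_subset[OF assms(2,1)] by simp
  ultimately show ?thesis using card_mono by (metis min.coboundedI2)
qed

locale uniform_secretary = multisecretary +
  assumes F_uniform: "F = quantile_law (\<lambda>q. q)"
begin

lemma F_eq: "F = density lborel (\<lambda>x. ennreal (indicator {0..1} x))"
proof -
  have "F = uniform_measure lborel {0..1}"
    unfolding F_uniform quantile_law_def by (rule distr_id2) simp
  thus ?thesis unfolding uniform_measure_def
    by (auto simp: indicator_def intro!: density_cong)
qed

lemma measure_F: "A \<in> sets borel \<Longrightarrow> measure F A = measure lborel ({0..1} \<inter> A)"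
proof -
  interpret quantile_function "\<lambda>q::real. q" by unfold_locales (auto intro: monoI)
  show "A \<in> sets borel \<Longrightarrow> measure F A = measure lborel ({0..1} \<inter> A)"
    unfolding F_uniform by (subst measure_quantile_law) auto
qed

lemma F_above: "0 \<le> x \<Longrightarrow> x \<le> 1 \<Longrightarrow> measure F {x<..} = 1 - x"
proof -
  assume x: "0 \<le> x" "x \<le> 1"
  hence "{0..1} \<inter> {x<..} = {x<..1}" by auto
  thus ?thesis using x by (simp add: measure_F)
qed

lemma F_below: "0 \<le> x \<Longrightarrow> x \<le> 1 \<Longrightarrow> measure F {..<x} = x"
proof -
  assume x: "0 \<le> x" "x \<le> 1"
  hence "{0..1} \<inter> {..<x} = {0..<x}" by auto
  thus ?thesis using x by (simp add: measure_F)
qed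

lemma AE_F: "AE x in F. x \<in> {0..1}"
  unfolding F_eq by (subst AE_density) (auto simp: indicator_def)

lemma has_bochner_integral_F:
  fixes f G :: "real \<Rightarrow> real"
  assumes ab: "0 \<le> a" "a \<le> b" "b \<le> 1"
    and G: "\<And>x. (G has_real_derivative f x) (at x)" and f: "continuous_on UNIV f"
  shows "has_bochner_integral F (\<lambda>x. indicator {a..b} x * f x) (G b - G a)"
proof -
  have [measurable]: "f \<in> borel_measurable borel" using f by (rule borel_measurable_continuous_onI)
  have "has_bochner_integral lborel (\<lambda>x. f x * indicator {a..b} x) (G b - G a)"
    using ab G f by (intro has_bochner_integral_FTC_Icc_real)
      (auto intro: continuous_on_interior simp: continuous_on_eq_continuous_at)
  also have "(\<lambda>x. f x * indicator {a..b} x) = (\<lambda>x. indicator {0..1} x *\<^sub>R (indicator {a..b} x * f x))"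
    using ab by (auto simp: indicator_def fun_eq_iff)
  finally show ?thesis unfolding F_eq
    by (intro has_bochner_integral_density) auto
qed

text \<open>
  If the success probability is itself uniform, the number of successes is uniform on \<open>{0..n}\<close>. Consecutive
  weights differ by the derivative of a multiple of \<open>x ^ (n - k) * (1 - x) ^ (k + 1)\<close>, which vanishes at
  both end points, so all weights have the same integral.
\<close>
lemma integral_binomial_weight:
  assumes "k \<le> n"
  shows "has_bochner_integral F (\<lambda>x. indicator {0..1} x * (real (n choose k) * (1 - x) ^ k * x ^ (n - k))) (1 / real (n + 1))"
  using assms
proof (induction k)
  case 0
  have "has_bochner_integral F (\<lambda>x. indicator {0..1} x * (x ^ n)) (1 ^ (n + 1) / real (n + 1) - 0 ^ (n + 1) / real (n + 1))"
    by (rule has_bochner_integral_F) (auto intro!: derivative_eq_intros continuous_intros simp del: power_Suc)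
  thus ?case by simp
next
  case (Suc k)
  define j where "j = n - Suc k"
  have n: "n - k = Suc j" "n = Suc (j + k)" using Suc.prems by (auto simp: j_def)
  let ?w = "\<lambda>k x::real. real (n choose k) * (1 - x) ^ k * x ^ (n - k)"
  let ?c = "real (n choose Suc k) / real (Suc j)"
  \<comment> \<open>The constant \<open>?c\<close> below is chosen so that the two product-rule terms are the two consecutive weights.\<close>
  have choose: "real (n choose k) * real (Suc j) = real (n choose Suc k) * real (Suc k)"
  proof -
    have "Suc j * (n choose k) = Suc k * (n choose Suc k)"
      using binomial_absorb_comp[of n k] binomial_absorption[of k n] unfolding n(1) by simp
    hence "real (Suc j * (n choose k)) = real (Suc k * (n choose Suc k))" by (simp only:)
    thus ?thesis by (simp only: of_nat_mult mult.commute)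
  qed
  have "has_bochner_integral F (\<lambda>x. indicator {0..1} x * (?w (Suc k) x - ?w k x))
    (?c * (1 ^ Suc j * (1 - 1) ^ Suc k) - ?c * (0 ^ Suc j * (1 - 0) ^ Suc k))"
  proof (rule has_bochner_integral_F)
    fix x :: real
    have w: "?w (Suc k) x - ?w k x = ?c * (real (Suc j) * x ^ j * (1 - x) ^ Suc k - x ^ Suc j * (real (Suc k) * (1 - x) ^ k))"
    proof -
      have "real (n choose k) = ?c * real (Suc k)" using choose by (simp add: field_simps)
      moreover have "real (n choose Suc k) = ?c * real (Suc j)" by simp
      moreover have "d * (s * p * q - r * (u * w)) = (d * s) * q * p - (d * u) * w * r" for d s p q r u w :: real
        by (simp add: algebra_simps)
      ultimately show ?thesis unfolding n(1) j_def[symmetric] by (simp only:)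
    qed
    have "((\<lambda>x. x ^ Suc j) has_real_derivative real (Suc j) * x ^ j) (at x)"
      "((\<lambda>x. (1 - x) ^ Suc k) has_real_derivative - (real (Suc k) * (1 - x) ^ k)) (at x)"
      by (auto intro!: derivative_eq_intros simp del: power_Suc)
    from DERIV_cmult[OF DERIV_mult[OF this], of ?c]
    show "((\<lambda>x. ?c * (x ^ Suc j * (1 - x) ^ Suc k)) has_real_derivative (?w (Suc k) x - ?w k x)) (at x)"
      unfolding w by (simp only: algebra_simps mult_minus_right add_uminus_conv_diff)
  qed (auto intro!: continuous_intros)
  from has_bochner_integral_add[OF this Suc.IH] Suc.prems
  show ?case by (simp add: algebra_simps)
qed

end

context uniform_secretary begin

text \<open>
  Layer-cake representation of the sum of the \<open>B\<close> largest abilities.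
\<close>
lemma best_ge_integral:
  assumes ab: "\<forall>t\<in>{1..T}. ability t \<omega> \<in> {0..1}"
  shows "(\<integral>x. real (min B (tally {1..T} {x<..} \<omega>)) \<partial>F) \<le> best B \<omega>"
proof -
  interpret F: prob_space F by (rule prob_space_F)
  obtain S where S: "S \<subseteq> {1..T}" "card S = min B (card {1..T})"
    "\<forall>i\<in>S. \<forall>j\<in>{1..T} - S. ability j \<omega> \<le> ability i \<omega>"
    using ex_top_subset[of "{1..T}" B "\<lambda>t. ability t \<omega>"] by auto
  have fin: "finite S" using S(1) by (rule finite_subset) simp
  have le: "real (min B (tally {1..T} {x<..} \<omega>)) \<le> (\<Sum>i\<in>S. indicator {..<ability i \<omega>} x)" for x
  proof -
    have "min B (tally {1..T} {x<..} \<omega>) \<le> card {i\<in>S. ability i \<omega> > x}"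
      using min_card_above_le[OF _ S, of x] by (simp add: tally_def)
    also have "real \<dots> = (\<Sum>i\<in>S. indicator {..<ability i \<omega>} x)"
      using fin by (simp add: indicator_def sum.If_cases Int_def)
    finally show ?thesis by simp
  qed
  have int: "integrable F (\<lambda>x. indicator {..<ability i \<omega>} x :: real)" for i
    by (intro F.integrable_const_bound[of _ 1]) auto
  have "(\<integral>x. real (min B (tally {1..T} {x<..} \<omega>)) \<partial>F) \<le> (\<integral>x. (\<Sum>i\<in>S. indicator {..<ability i \<omega>} x) \<partial>F)"
    using int le by (intro integral_mono') (auto intro!: sum_nonneg)
  also have "\<dots> = (\<Sum>i\<in>S. measure F {..<ability i \<omega>})"
    using int by (subst Bochner_Integration.integral_sum) auto
  also have "\<dots> = (\<Sum>i\<in>S. ability i \<omega>)"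
    using ab S(1) by (intro sum.cong refl F_below) auto
  also have "\<dots> \<le> best B \<omega>" using S by (intro best_ge) auto
  finally show ?thesis .
qed

lemma sum_min:
  assumes "B \<le> T"
  shows "(\<Sum>k\<le>T. real (min B k)) = real B * real (T + 1) - real B * real (B + 1) / 2"
  using assms
proof (induction T)
  case (Suc n)
  show ?case
  proof (cases "B \<le> n")
    case True thus ?thesis using Suc.IH by (simp add: algebra_simps)
  next
    case False
    hence "B = Suc n" using Suc.prems by simp
    moreover have "(\<Sum>k\<le>Suc n. real (min (Suc n) k)) = (\<Sum>k\<le>Suc n. real k)" by (intro sum.cong) auto
    moreover have "(\<Sum>k\<le>m. real k) = real m * real (m + 1) / 2" for m
      by (induction m) (auto simp: field_simps)
    ultimately show ?thesis by (simp add: field_simps)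
  qed
qed simp

text \<open>
  The layer-cake integral is averaged with the two integrations exchanged: the level \<open>x\<close> is then
  a uniform success probability for the tally above \<open>x\<close>, which is therefore uniform on \<open>{0..T}\<close>.
\<close>
lemma expectation_best_ge:
  assumes B: "B \<le> T"
  shows "expectation (best B) \<ge> B - real B * real (B + 1) / (2 * real (T + 1))"
proof -
  interpret F: prob_space F by (rule prob_space_F)
  interpret PF: pair_prob_space P F ..
  define h where "h \<omega> x = min (real B) (\<Sum>t\<in>{1..T}. if x < ability t \<omega> then 1 else 0)" for \<omega> and x :: real
  have h_eq: "h \<omega> x = real (min B (tally {1..T} {x<..} \<omega>))" for \<omega> x
    unfolding of_nat_min tally_eq_sum[OF finite_atLeastAtMost] h_def
    by (intro arg_cong[of _ _ "min (real B)"] sum.cong) (auto simp: indicator_def)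
  have h_meas: "(\<lambda>(\<omega>, x). h \<omega> x) \<in> borel_measurable (P \<Otimes>\<^sub>M F)"
    "(\<lambda>(x, \<omega>). h \<omega> x) \<in> borel_measurable (F \<Otimes>\<^sub>M P)"
    unfolding h_def split_beta' using measurable_ability by measurable
  have int: "integrable (P \<Otimes>\<^sub>M F) (\<lambda>(\<omega>, x). h \<omega> x)"
    using h_meas(1) by (intro PF.integrable_const_bound[of _ "real B"]) (auto simp: h_eq)
  have E: "expectation (\<lambda>\<omega>. h \<omega> x) = (\<Sum>k\<le>T. real (min B k) * (real (T choose k) * (1 - x) ^ k * x ^ (T - k)))"
    if x: "x \<in> {0..1}" for x
  proof -
    have "expectation (\<lambda>\<omega>. h \<omega> x) = measure_pmf.expectation (binomial_pmf T (1 - x)) (\<lambda>k. real (min B k))"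
      unfolding h_eq using expectation_tally[of "{x<..}" "{1..T}" "\<lambda>k. real (min B k)"] x by (simp add: F_above)
    also have "\<dots> = (\<Sum>k\<le>T. real (min B k) * (real (T choose k) * (1 - x) ^ k * x ^ (T - k)))"
      using x by (subst expectation_binomial_pmf') (auto simp: mult_ac)
    finally show ?thesis .
  qed
  have "has_bochner_integral F (\<lambda>x. \<Sum>k\<le>T. real (min B k) * (indicator {0..1} x * (real (T choose k) * (1 - x) ^ k * x ^ (T - k))))
      (\<Sum>k\<le>T. real (min B k) * (1 / real (T + 1)))"
    by (intro has_bochner_integral_sum has_bochner_integral_mult_right integral_binomial_weight) auto
  hence "(\<Sum>k\<le>T. real (min B k) * (1 / real (T + 1)))
      = (\<integral>x. (\<Sum>k\<le>T. real (min B k) * (indicator {0..1} x * (real (T choose k) * (1 - x) ^ k * x ^ (T - k)))) \<partial>F)"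
    by (rule has_bochner_integral_integral_eq[symmetric])
  also have "\<dots> = (\<integral>x. expectation (\<lambda>\<omega>. h \<omega> x) \<partial>F)"
  proof (rule integral_cong_AE)
    show "(\<lambda>x. expectation (\<lambda>\<omega>. h \<omega> x)) \<in> borel_measurable F"
      by (rule borel_measurable_lebesgue_integral[OF h_meas(2)])
    show "AE x in F. (\<Sum>k\<le>T. real (min B k) * (indicator {0..1} x * (real (T choose k) * (1 - x) ^ k * x ^ (T - k))))
        = expectation (\<lambda>\<omega>. h \<omega> x)"
      using AE_F by eventually_elim (simp add: E)
  qed measurable
  also have "\<dots> = (\<integral>\<omega>. (\<integral>x. h \<omega> x \<partial>F) \<partial>P)"
    by (rule PF.Fubini_integral[OF int])
  also have "\<dots> \<le> expectation (best B)"
  proof (rule integral_mono_AE)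
    show "integrable P (\<lambda>\<omega>. \<integral>x. h \<omega> x \<partial>F)" using PF.integrable_fst[OF int] .
    show "AE \<omega> in P. (\<integral>x. h \<omega> x \<partial>F) \<le> best B \<omega>"
      using AE_ability unfolding h_eq by eventually_elim (rule best_ge_integral)
  qed (rule integrable_best)
  finally show ?thesis using B
    by (simp add: sum_distrib_right[symmetric] sum_divide_distrib[symmetric] sum_min field_simps)
qed

end

section \<open>A price martingale and logarithmic regret\<close>

text \<open>
  The final price may become negative, where it would not be a valid price for unused budget. The fourth
  power charges for this rare event and has an expectation that can be computed.
\<close>
lemma pospart_le_quartic: 
  fixes z :: real
  shows "max 0 (1/2 + z) \<le> 1/2 + z + 8 * z ^ 4"
proof (cases "0 \<le> 1/2 + z")
  case False
  define y where "y = - z"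
  have y: "1/2 < y" using False by (simp add: y_def)
  have "(1/2) ^ 3 \<le> y ^ 3" using y by (intro power_mono) auto
  hence "1 * y \<le> (8 * y ^ 3) * y" using y by (intro mult_right_mono) (auto simp: power3_eq_cube)
  hence "y \<le> 8 * y ^ 4" by (simp add: power3_eq_cube power4_eq_xxxx)
  thus ?thesis using False by (simp add: y_def)
qed simp

text \<open>
  Telescoping \<open>1 / s\<^sup>2 \<le> 1 / (s - 1) - 1 / s\<close>.
\<close>
lemma sum_inverse_squares_le:
  assumes "1 \<le> m"
  shows "(\<Sum>s\<in>{m<..m + n}. 1 / (real s)\<^sup>2) \<le> 1 / real m - 1 / real (m + n)"
proof (induction n)
  case (Suc n)
  have "{m<..m + Suc n} = insert (m + Suc n) {m<..m + n}" by auto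
  hence "(\<Sum>s\<in>{m<..m + Suc n}. 1 / (real s)\<^sup>2) = (\<Sum>s\<in>{m<..m + n}. 1 / (real s)\<^sup>2) + 1 / (real (m + Suc n))\<^sup>2"
    by simp
  also have "1 / (real (m + Suc n))\<^sup>2 \<le> 1 / (real (m + n) * real (m + Suc n))"
    using assms unfolding power2_eq_square by (intro frac_le mult_right_mono) auto
  also have "\<dots> = 1 / real (m + n) - 1 / real (m + Suc n)"
    using assms by (simp add: field_simps)
  finally show ?case using Suc.IH by simp
qed simp

text \<open>
  Telescoping \<open>ln ((s + 1) / s) \<le> 1 / s\<close>.
\<close>
lemma sum_inverse_ge_ln:
  "ln (real (m + n + 1)) - ln (real (m + 1)) \<le> (\<Sum>s\<in>{m<..m + n}. 1 / real s)"
proof (induction n)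
  case (Suc n)
  have "{m<..m + Suc n} = insert (m + Suc n) {m<..m + n}" by auto
  hence "(\<Sum>s\<in>{m<..m + Suc n}. 1 / real s) = (\<Sum>s\<in>{m<..m + n}. 1 / real s) + 1 / real (m + Suc n)"
    by simp
  moreover have "ln (real (m + Suc n + 1)) - ln (real (m + n + 1)) \<le> 1 / real (m + Suc n)"
  proof -
    have "ln (real (m + Suc n + 1)) - ln (real (m + n + 1)) = ln (real (m + Suc n + 1) / real (m + n + 1))"
      by (subst ln_div) auto
    also have "\<dots> \<le> real (m + Suc n + 1) / real (m + n + 1) - 1" by (rule ln_le_minus_one) auto
    also have "\<dots> = 1 / real (m + Suc n)" by (simp add: field_simps)
    finally show ?thesis .
  qed
  ultimately show ?case using Suc.IH by linarith
qed simp

locale price_martingale = uniform_secretary +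
  fixes h :: nat
  assumes h: "1 \<le> h" "h \<le> T" "T \<le> h\<^sup>2"
begin

text \<open>The price at time \<open>t\<close> is \<open>1/2 + z t\<close>. With \<open>T - t + 1\<close> periods to go, including the current one, its
  step size is proportional to the inverse of that number; the factor \<open>1/2\<close> makes the linear gain twice
  the quadratic cost. In the last \<open>h\<close> periods the price is frozen, since with few periods to go its
  fluctuations would make it negative too often; \<open>h \<ge> \<surd>T\<close> keeps this risk of order \<open>1/T\<close>, and \<open>h\<close> close
  to \<open>\<surd>T\<close> still leaves half of the logarithm.
  \<open>V t\<close> is the variance of \<open>z t\<close>.\<close>
definition k :: "nat \<Rightarrow> real" where
  "k t = (if t \<le> T - h then 1 / (2 * real (T - t + 1)) else 0)"

definition coin :: "nat \<Rightarrow> scenario \<Rightarrow> real" where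
  "coin t \<omega> = of_bool (ability t \<omega> > 1/2) - 1/2"

definition z :: "nat \<Rightarrow> scenario \<Rightarrow> real" where
  "z t \<omega> = (\<Sum>r=1..t. k r * coin r \<omega>)"

definition V :: "nat \<Rightarrow> real" where
  "V t = (\<Sum>r=1..t. (k r)\<^sup>2 / 4)"

lemma z_0: "z 0 \<omega> = 0" and z_Suc: "z (Suc t) \<omega> = z t \<omega> + k (Suc t) * coin (Suc t) \<omega>"
  and V_0: "V 0 = 0" and V_Suc: "V (Suc t) = V t + (k (Suc t))\<^sup>2 / 4"
  by (simp_all add: z_def V_def)

lemma k_bounds: "0 \<le> k t" "k t \<le> 1/2" by (auto simp: k_def)

lemma coin_sq: "(coin t \<omega>)\<^sup>2 = 1/4" and coin_abs: "\<bar>coin t \<omega>\<bar> \<le> 1"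
  by (auto simp: coin_def power2_eq_square)

lemma z_abs: "\<bar>z t \<omega>\<bar> \<le> real t"
proof -
  have "\<bar>z t \<omega>\<bar> \<le> (\<Sum>r=1..t. \<bar>k r * coin r \<omega>\<bar>)" unfolding z_def by (rule sum_abs)
  also have "\<dots> \<le> (\<Sum>r=1..t. 1)"
  proof (rule sum_mono)
    fix r
    have "\<bar>k r\<bar> * \<bar>coin r \<omega>\<bar> \<le> 1 * 1" using k_bounds[of r] coin_abs[of r \<omega>] by (intro mult_mono) auto
    thus "\<bar>k r * coin r \<omega>\<bar> \<le> 1" by (simp add: abs_mult)
  qed
  finally show ?thesis by simp
qed

lemma coin_history: "t \<in> {1..s} \<Longrightarrow> coin t \<in> borel_measurable (history F T s)"
  unfolding coin_def[abs_def] of_bool_def using ability_history[of t s] by measurable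

lemma z_history: "t \<le> s \<Longrightarrow> z t \<in> borel_measurable (history F T s)"
  unfolding z_def[abs_def] by (intro borel_measurable_sum borel_measurable_times coin_history) auto

lemma integrable_bounded_history:
  fixes X :: "scenario \<Rightarrow> real"
  assumes "X \<in> borel_measurable (history F T t)" "t \<le> T" "\<forall>\<omega>\<in>space P. \<bar>X \<omega>\<bar> \<le> C"
  shows "integrable P X"
  by (rule integrable_const_bound[of _ C, OF AE_I2 measurable_history[OF assms(2,1)]]) (simp add: assms(3))

lemma measure_above_half: "measure F {1/2<..} = 1/2" using F_above[of "1/2"] by simp

lemma expectation_mult_coin:
  assumes X: "X \<in> borel_measurable (history F T s)" "\<forall>\<omega>\<in>space P. \<bar>X \<omega>\<bar> \<le> C" and t: "s < t" "t \<le> T"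
  shows "expectation (\<lambda>\<omega>. X \<omega> * coin t \<omega>) = 0" "integrable P (\<lambda>\<omega>. X \<omega> * coin t \<omega>)"
proof -
  interpret F: prob_space F by (rule prob_space_F)
  let ?f = "\<lambda>(x :: real, y :: real). x * (indicator {1/2<..} y - 1/2) :: real"
  have f: "?f \<in> borel_measurable borel" unfolding borel_prod[symmetric] split_beta' by measurable
  have coin: "coin t \<omega> = indicator {1/2<..} (ability t \<omega>) - 1/2" for \<omega> by (simp add: coin_def indicator_def)
  have "(\<lambda>\<omega>. X \<omega> * coin t \<omega>) \<in> borel_measurable (history F T t)"
    using t by (intro borel_measurable_times coin_history history_mono[OF _ X(1)]) auto
  moreover have "\<forall>\<omega>\<in>space P. \<bar>X \<omega> * coin t \<omega>\<bar> \<le> C"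
  proof
    fix \<omega> assume "\<omega> \<in> space P"
    hence "\<bar>X \<omega>\<bar> \<le> C" using X(2) by blast
    hence "\<bar>X \<omega>\<bar> * \<bar>coin t \<omega>\<bar> \<le> C * 1" using coin_abs[of t \<omega>] by (intro mult_mono) auto
    thus "\<bar>X \<omega> * coin t \<omega>\<bar> \<le> C" by (simp add: abs_mult)
  qed
  ultimately show int: "integrable P (\<lambda>\<omega>. X \<omega> * coin t \<omega>)" using t(2) by (intro integrable_bounded_history)
  have "expectation (\<lambda>\<omega>. ?f (X \<omega>, ability t \<omega>)) = expectation (\<lambda>\<omega>. \<integral>y. ?f (X \<omega>, y) \<partial>F)"
    using t int by (intro integral_history_ability[OF X(1) _ f]) (auto simp: coin)
  also have "\<dots> = expectation (\<lambda>\<omega>. 0)"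
  proof (rule Bochner_Integration.integral_cong[OF refl])
    fix \<omega>
    have i: "integrable F (indicator {1/2<..} :: real \<Rightarrow> real)"
      by (intro F.integrable_const_bound[of _ 1]) auto
    have u: "F.prob UNIV = 1" using F.prob_space by simp
    have "(\<integral>y. indicator {1/2<..} y - 1/2 \<partial>F) = (0 :: real)"
      using measure_above_half i u by (subst Bochner_Integration.integral_diff) auto
    thus "(\<integral>y. ?f (X \<omega>, y) \<partial>F) = 0" by simp
  qed
  finally show "expectation (\<lambda>\<omega>. X \<omega> * coin t \<omega>) = 0" by (simp add: coin)
qed

lemma z_power_abs: "\<bar>z t \<omega> ^ n\<bar> \<le> real t ^ n"
  unfolding power_abs using z_abs[of t \<omega>] by (intro power_mono) auto

lemma z_power_history: "t \<le> s \<Longrightarrow> (\<lambda>\<omega>. z t \<omega> ^ n) \<in> borel_measurable (history F T s)"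
  by (intro borel_measurable_power z_history)

lemma integrable_z_power: "t \<le> T \<Longrightarrow> integrable P (\<lambda>\<omega>. z t \<omega> ^ n)"
  using z_power_history[of t t n] z_power_abs[of t _ n]
  by (intro integrable_bounded_history[where t = t and C = "real t ^ n"]) auto

lemma expectation_z_power_coin:
  assumes "Suc t \<le> T"
  shows "expectation (\<lambda>\<omega>. z t \<omega> ^ n * coin (Suc t) \<omega>) = 0" "integrable P (\<lambda>\<omega>. z t \<omega> ^ n * coin (Suc t) \<omega>)"
  using expectation_mult_coin[OF z_power_history[of t t n], of "real t ^ n" "Suc t"] z_power_abs[of t _ n] assms
  by auto

text \<open>
  The increments are symmetric with squares \<open>(k t)\<^sup>2 / 4\<close> that do not depend on the scenario, so second
  and fourth moments obey recursions without further unknowns. The bound \<open>3 (V t)\<^sup>2\<close> is the Gaussian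
  fourth moment.
\<close>
lemma z_moments:
  assumes "t \<le> T"
  shows "expectation (z t) = 0" "expectation (\<lambda>\<omega>. (z t \<omega>)\<^sup>2) = V t"
    "expectation (\<lambda>\<omega>. z t \<omega> ^ 4) \<le> 3 * (V t)\<^sup>2"
proof -
  have "expectation (z t) = 0 \<and> expectation (\<lambda>\<omega>. (z t \<omega>)\<^sup>2) = V t \<and> expectation (\<lambda>\<omega>. z t \<omega> ^ 4) \<le> 3 * (V t)\<^sup>2"
    using assms
  proof (induction t)
    case 0 show ?case by (simp add: z_0 V_0)
  next
    case (Suc t)
    let ?c = "\<lambda>n \<omega>. z t \<omega> ^ n * coin (Suc t) \<omega>" and ?k = "k (Suc t)"
    define q where "q = ?k\<^sup>2 / 4"
    note c = expectation_z_power_coin[OF Suc.prems]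
    have t: "t \<le> T" using Suc.prems by simp
    note i = integrable_z_power[OF t]
    have IH: "expectation (z t) = 0" "expectation (\<lambda>\<omega>. (z t \<omega>)\<^sup>2) = V t" "expectation (\<lambda>\<omega>. z t \<omega> ^ 4) \<le> 3 * (V t)\<^sup>2"
      using Suc.IH t by auto
    have "expectation (z (Suc t)) = expectation (\<lambda>\<omega>. z t \<omega> ^ 1 + ?k * ?c 0 \<omega>)"
      by (intro Bochner_Integration.integral_cong) (simp_all add: z_Suc)
    also have "\<dots> = 0" using c[of 0] i[of 1] IH(1) by simp
    finally have 1: "expectation (z (Suc t)) = 0" .
    have sq: "(z (Suc t) \<omega>)\<^sup>2 = z t \<omega> ^ 2 + (2 * ?k * ?c 1 \<omega> + q)" for \<omega>
      using coin_sq[of "Suc t" \<omega>] by (simp add: z_Suc q_def power2_sum power_mult_distrib)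
    have "expectation (\<lambda>\<omega>. (z (Suc t) \<omega>)\<^sup>2) = V t + (2 * ?k * 0 + q)"
      unfolding sq using c[of 1] i[of 2] IH(2) by (simp add: prob_space)
    hence 2: "expectation (\<lambda>\<omega>. (z (Suc t) \<omega>)\<^sup>2) = V (Suc t)" by (simp add: V_Suc q_def)
    have qd: "z (Suc t) \<omega> ^ 4 = z t \<omega> ^ 4 + (6 * q * z t \<omega> ^ 2 + (4 * ?k * ?c 3 \<omega> + (4 * ?k * q * ?c 1 \<omega> + q\<^sup>2)))" for \<omega>
    proof -
      have expand: "(x + y) ^ 4 = x ^ 4 + (6 * y\<^sup>2 * x ^ 2 + (4 * x ^ 3 * y + (4 * y\<^sup>2 * x * y + (y\<^sup>2)\<^sup>2)))" for x y :: real
        by (simp add: power2_eq_square power3_eq_cube power4_eq_xxxx algebra_simps)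
      have "(?k * coin (Suc t) \<omega>)\<^sup>2 = q" using coin_sq[of "Suc t" \<omega>] by (simp add: q_def power_mult_distrib)
      from expand[of "z t \<omega>" "?k * coin (Suc t) \<omega>", unfolded this] show ?thesis
        unfolding z_Suc by (simp add: mult_ac)
    qed
    have "expectation (\<lambda>\<omega>. z (Suc t) \<omega> ^ 4) = expectation (\<lambda>\<omega>. z t \<omega> ^ 4) + (6 * q * V t + (4 * ?k * 0 + (4 * ?k * q * 0 + q\<^sup>2)))"
      unfolding qd using c[of 1] c[of 3] i[of 2] i[of 4] IH(2) by (simp add: prob_space)
    also have "\<dots> \<le> 3 * (V t)\<^sup>2 + 6 * q * V t + 3 * q\<^sup>2" using IH(3) zero_le_power2[of q] by linarith
    also have "\<dots> = 3 * (V t + q)\<^sup>2" by (simp add: power2_eq_square algebra_simps)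
    also have "V t + q = V (Suc t)" by (simp add: V_Suc q_def)
    finally show ?case using 1 2 by simp
  qed
  thus "expectation (z t) = 0" "expectation (\<lambda>\<omega>. (z t \<omega>)\<^sup>2) = V t"
    "expectation (\<lambda>\<omega>. z t \<omega> ^ 4) \<le> 3 * (V t)\<^sup>2" by auto
qed

text \<open>
  The martingale property: a decision taken at time \<open>t\<close> may be charged at any later price.
\<close>
lemma final_price_expectation:
  assumes X: "X \<in> borel_measurable (history F T t)" "\<forall>\<omega>\<in>space P. \<bar>X \<omega>\<bar> \<le> 1" and t: "t \<le> s" "s \<le> T"
  shows "expectation (\<lambda>\<omega>. z s \<omega> * X \<omega>) = expectation (\<lambda>\<omega>. z t \<omega> * X \<omega>)"
    and "integrable P (\<lambda>\<omega>. z s \<omega> * X \<omega>)"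
proof -
  have int: "integrable P (\<lambda>\<omega>. z s \<omega> * X \<omega>)" if "t \<le> s" "s \<le> T" for s
  proof (rule integrable_bounded_history)
    show "(\<lambda>\<omega>. z s \<omega> * X \<omega>) \<in> borel_measurable (history F T s)"
      using that by (intro borel_measurable_times z_history history_mono[OF _ X(1)]) auto
    show "\<forall>\<omega>\<in>space P. \<bar>z s \<omega> * X \<omega>\<bar> \<le> real s * 1"
      unfolding abs_mult using X(2) z_abs[of s] by (intro ballI mult_mono) auto
  qed (use that in simp)
  show "integrable P (\<lambda>\<omega>. z s \<omega> * X \<omega>)" using t by (rule int)
  show "expectation (\<lambda>\<omega>. z s \<omega> * X \<omega>) = expectation (\<lambda>\<omega>. z t \<omega> * X \<omega>)"
    using t
  proof (induction s rule: dec_induct)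
    case (step s)
    have s: "s \<le> T" "t < Suc s" using step by auto
    note c = expectation_mult_coin[OF X s(2) step.prems]
    have "expectation (\<lambda>\<omega>. z (Suc s) \<omega> * X \<omega>) = expectation (\<lambda>\<omega>. z s \<omega> * X \<omega> + k (Suc s) * (X \<omega> * coin (Suc s) \<omega>))"
      by (simp add: z_Suc algebra_simps)
    also have "\<dots> = expectation (\<lambda>\<omega>. z s \<omega> * X \<omega>) + k (Suc s) * 0"
      using c int[OF step.hyps(1) s(1)] by (simp only: Bochner_Integration.integral_add integrable_mult_right integral_mult_right_zero)
    finally show ?case using step.IH s by simp
  qed simp
qed

text \<open>
  The linear term \<open>- \<kappa>/4\<close> is the gain from letting the price move with the candidate: it rises on the
  candidates above \<open>1/2\<close>, which are the ones that count. The quadratic terms are the cost of a price away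
  from \<open>1/2\<close>.
\<close>
lemma step_integral_le:
  fixes x \<kappa> :: real
  shows "(\<integral>y. max 0 (y - 1/2 - (x + \<kappa> * (of_bool (y > 1/2) - 1/2))) \<partial>F) \<le> 1/8 - x/2 - \<kappa>/4 + x\<^sup>2 + \<kappa>\<^sup>2/4"
proof -
  define c1 c2 where "c1 = 1/2 + x + \<kappa>/2" and "c2 = 1/2 + x - \<kappa>/2"
  let ?u = "\<lambda>y. indicator {1/2..1} y * max 0 (y - c1) + indicator {0..1/2} y * max 0 (y - c2)"
  let ?G = "\<lambda>c y::real. (max 0 (y - c))\<^sup>2 / 2"
  have "has_bochner_integral F ?u ((?G c1 1 - ?G c1 (1/2)) + (?G c2 (1/2) - ?G c2 0))"
    by (intro has_bochner_integral_add has_bochner_integral_F has_derivative_half_square_pospart continuous_intros) auto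
  hence int: "integrable F ?u" and val: "integral\<^sup>L F ?u = (?G c1 1 - ?G c1 (1/2)) + (?G c2 (1/2) - ?G c2 0)"
    by (auto simp: has_bochner_integral_iff)
  have "AE y in F. max 0 (y - 1/2 - (x + \<kappa> * (of_bool (y > 1/2) - 1/2))) \<le> ?u y"
    using AE_F by eventually_elim (auto simp: c1_def c2_def indicator_def algebra_simps)
  hence "(\<integral>y. max 0 (y - 1/2 - (x + \<kappa> * (of_bool (y > 1/2) - 1/2))) \<partial>F) \<le> integral\<^sup>L F ?u"
    by (intro integral_mono_AE'[OF int]) auto
  also have "\<dots> \<le> (1 - c1)\<^sup>2 / 2 + (1/2 - c2)\<^sup>2 / 2"
  proof -
    have sq: "(max 0 r)\<^sup>2 \<le> r\<^sup>2" for r :: real by (auto simp: max_def)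
    have "?G c1 1 - ?G c1 (1/2) \<le> (1 - c1)\<^sup>2 / 2 - 0" "?G c2 (1/2) - ?G c2 0 \<le> (1/2 - c2)\<^sup>2 / 2 - 0"
      using sq by (intro diff_mono divide_right_mono; simp)+
    thus ?thesis unfolding val by linarith
  qed
  also have "\<dots> = 1/8 - x/2 - \<kappa>/4 + x\<^sup>2 + \<kappa>\<^sup>2/4"
    by (simp add: c1_def c2_def power2_eq_square field_simps)
  finally show ?thesis .
qed

lemma step_value_le:
  assumes t: "t \<in> {1..T}"
  shows "expectation (\<lambda>\<omega>. max 0 (ability t \<omega> - 1/2 - z t \<omega>)) \<le> 1/8 - k t / 4 + V (t - 1) + (k t)\<^sup>2 / 4"
    and "integrable P (\<lambda>\<omega>. max 0 (ability t \<omega> - 1/2 - z t \<omega>))"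
proof -
  let ?f = "\<lambda>(x :: real, y :: real). max 0 (y - 1/2 - (x + k t * (indicator {1/2<..} y - 1/2)))"
  have f: "?f \<in> borel_measurable borel" unfolding borel_prod[symmetric] split_beta' by measurable
  have ind: "indicator {1/2<..} y = (of_bool (y > 1/2) :: real)" for y :: real by (simp add: indicator_def)
  have t': "Suc (t - 1) = t" "t \<in> {t - 1<..T}" "t - 1 \<le> T" using t by auto
  have eq: "max 0 (ability t \<omega> - 1/2 - z t \<omega>) = ?f (z (t - 1) \<omega>, ability t \<omega>)" for \<omega>
    using z_Suc[of "t - 1" \<omega>] t'(1) by (simp add: coin_def ind)
  have meas: "(\<lambda>\<omega>. max 0 (ability t \<omega> - 1/2 - z t \<omega>)) \<in> borel_measurable P"
    using t measurable_history[OF _ z_history[of t t]]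
    by (intro borel_measurable_max borel_measurable_diff measurable_ability) auto
  have "AE \<omega> in P. norm (max 0 (ability t \<omega> - 1/2 - z t \<omega>)) \<le> 1 + real t"
    using AE_ability
  proof eventually_elim
    case (elim \<omega>)
    hence "0 \<le> ability t \<omega>" "ability t \<omega> \<le> 1" using t by auto
    thus ?case using z_abs[of t \<omega>] by auto
  qed
  thus int: "integrable P (\<lambda>\<omega>. max 0 (ability t \<omega> - 1/2 - z t \<omega>))"
    using meas by (rule integrable_const_bound)
  note E = integral_history_ability[OF z_history[OF order_refl] t'(2) f, folded eq, OF int]
  have i: "integrable P (z (t - 1))" "integrable P (\<lambda>\<omega>. (z (t - 1) \<omega>)\<^sup>2)"
    using integrable_z_power[OF t'(3), of 1] integrable_z_power[OF t'(3), of 2] by simp_all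
  have "expectation (\<lambda>\<omega>. max 0 (ability t \<omega> - 1/2 - z t \<omega>))
      \<le> expectation (\<lambda>\<omega>. (1/8 - k t / 4 + (k t)\<^sup>2 / 4) + ((-1/2) * z (t - 1) \<omega> + (z (t - 1) \<omega>)\<^sup>2))"
    unfolding E(1)
  proof (rule integral_mono[OF E(2)])
    show "integrable P (\<lambda>\<omega>. (1/8 - k t / 4 + (k t)\<^sup>2 / 4) + ((-1/2) * z (t - 1) \<omega> + (z (t - 1) \<omega>)\<^sup>2))"
      using i by (intro Bochner_Integration.integrable_add integrable_mult_right) auto
    show "(\<integral>y. ?f (z (t - 1) \<omega>, y) \<partial>F) \<le> (1/8 - k t / 4 + (k t)\<^sup>2 / 4) + ((-1/2) * z (t - 1) \<omega> + (z (t - 1) \<omega>)\<^sup>2)" for \<omega>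
      using step_integral_le[of "z (t - 1) \<omega>" "k t"] by (simp add: ind)
  qed
  also have "\<dots> = (1/8 - k t / 4 + (k t)\<^sup>2 / 4) + ((-1/2) * expectation (z (t - 1)) + expectation (\<lambda>\<omega>. (z (t - 1) \<omega>)\<^sup>2))"
  proof -
    have j: "integrable P (\<lambda>\<omega>. (-1/2) * z (t - 1) \<omega>)" using i(1) by (rule integrable_mult_right)
    show ?thesis
      using Bochner_Integration.integral_add[OF _ Bochner_Integration.integrable_add[OF j i(2)], of "\<lambda>_. 1/8 - k t / 4 + (k t)\<^sup>2 / 4"]
        Bochner_Integration.integral_add[OF j i(2)] by (simp add: prob_space)
  qed
  finally show "expectation (\<lambda>\<omega>. max 0 (ability t \<omega> - 1/2 - z t \<omega>)) \<le> 1/8 - k t / 4 + V (t - 1) + (k t)\<^sup>2 / 4"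
    using z_moments[OF t'(3)] by simp
qed

text \<open>
  Weak duality. Each ability is at most \<open>(\<theta>\<^sub>t - p\<^sub>t)\<^sup>+\<close> plus the price paid when hiring; by the martingale
  property every hire can be charged at the final price \<open>p\<^sub>T = 1/2 + z T\<close>, and there are at most \<open>B\<close> hires.
\<close>
lemma reward_le:
  assumes a: "a \<in> policies F B T"
  shows "expectation (\<lambda>\<omega>. \<Sum>t=1..T. ability t \<omega> * real (a t \<omega>))
    \<le> (\<Sum>t=1..T. 1/8 - k t / 4 + V (t - 1) + (k t)\<^sup>2 / 4) + real B * (1/2 + 24 * (V T)\<^sup>2)"
proof -
  define m where "m t \<omega> = max 0 (ability t \<omega> - 1/2 - z t \<omega>)" for t \<omega>
  define A where "A t \<omega> = real (a t \<omega>)" for t \<omega>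
  have A_meas: "A t \<in> borel_measurable (history F T t)" if "t \<in> {1..T}" for t
    unfolding A_def[abs_def] using policy_history[OF a that] .
  have A01: "A t \<omega> = 0 \<or> A t \<omega> = 1" if "t \<in> {1..T}" "\<omega> \<in> space P" for t \<omega>
    using policy_values[OF a that] by (auto simp: A_def)
  have A_bound: "\<forall>\<omega>\<in>space P. \<bar>A t \<omega>\<bar> \<le> 1" if "t \<in> {1..T}" for t using A01[OF that] by fastforce
  have int_A: "integrable P (A t)" if "t \<in> {1..T}" for t
    using integrable_bounded_history[OF A_meas[OF that] _ A_bound[OF that]] that by simp
  have int_m: "integrable P (m t)" and E_m: "expectation (m t) \<le> 1/8 - k t / 4 + V (t - 1) + (k t)\<^sup>2 / 4"
    if "t \<in> {1..T}" for t
    unfolding m_def[abs_def] using step_value_le[OF that] by auto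
  have int_zA: "integrable P (\<lambda>\<omega>. z s \<omega> * A t \<omega>)" if "t \<in> {1..T}" "t \<le> s" "s \<le> T" for s t
    using final_price_expectation(2)[OF A_meas A_bound] that by blast
  have int_pA: "integrable P (\<lambda>\<omega>. (1/2) * A t \<omega> + z s \<omega> * A t \<omega>)" if "t \<in> {1..T}" "t \<le> s" "s \<le> T" for s t
    using int_A[OF that(1)] int_zA[OF that] by (intro Bochner_Integration.integrable_add integrable_mult_right)
  have int_mpA: "integrable P (\<lambda>\<omega>. m t \<omega> + ((1/2) * A t \<omega> + z t \<omega> * A t \<omega>))" if t: "t \<in> {1..T}" for t
  proof -
    have "t \<le> T" using t by simp
    from Bochner_Integration.integrable_add[OF int_m[OF t] int_pA[OF t order_refl this]] show ?thesis .
  qed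
  have price: "expectation (\<lambda>\<omega>. (1/2) * A t \<omega> + z t \<omega> * A t \<omega>) = expectation (\<lambda>\<omega>. (1/2) * A t \<omega> + z T \<omega> * A t \<omega>)"
    if t: "t \<in> {1..T}" for t
  proof -
    have tT: "t \<le> T" using t by simp
    have i: "integrable P (\<lambda>\<omega>. (1/2) * A t \<omega>)" using int_A[OF t] by (rule integrable_mult_right)
    show ?thesis
      unfolding Bochner_Integration.integral_add[OF i int_zA[OF t order_refl tT]]
        Bochner_Integration.integral_add[OF i int_zA[OF t tT order_refl]]
      using final_price_expectation(1)[OF A_meas[OF t] A_bound[OF t] tT order_refl] by simp
  qed
  have "expectation (\<lambda>\<omega>. \<Sum>t=1..T. ability t \<omega> * real (a t \<omega>))
      \<le> expectation (\<lambda>\<omega>. \<Sum>t=1..T. m t \<omega> + ((1/2) * A t \<omega> + z t \<omega> * A t \<omega>))"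
  proof (rule integral_mono[OF integrable_collected[OF a]])
    show "integrable P (\<lambda>\<omega>. \<Sum>t=1..T. m t \<omega> + ((1/2) * A t \<omega> + z t \<omega> * A t \<omega>))"
      by (intro Bochner_Integration.integrable_sum int_mpA)
    fix \<omega> assume \<omega>: "\<omega> \<in> space P"
    show "(\<Sum>t=1..T. ability t \<omega> * real (a t \<omega>)) \<le> (\<Sum>t=1..T. m t \<omega> + ((1/2) * A t \<omega> + z t \<omega> * A t \<omega>))"
    proof (rule sum_mono)
      fix t assume t: "t \<in> {1..T}"
      show "ability t \<omega> * real (a t \<omega>) \<le> m t \<omega> + ((1/2) * A t \<omega> + z t \<omega> * A t \<omega>)"
        using A01[OF t \<omega>] unfolding A_def[symmetric] m_def by auto
    qed
  qed
  also have "\<dots> = (\<Sum>t=1..T. expectation (m t) + expectation (\<lambda>\<omega>. (1/2) * A t \<omega> + z t \<omega> * A t \<omega>))"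
  proof (subst Bochner_Integration.integral_sum)
    show "integrable P (\<lambda>\<omega>. m t \<omega> + ((1/2) * A t \<omega> + z t \<omega> * A t \<omega>))" if "t \<in> {1..T}" for t
      using that by (rule int_mpA)
    show "(\<Sum>t=1..T. expectation (\<lambda>\<omega>. m t \<omega> + ((1/2) * A t \<omega> + z t \<omega> * A t \<omega>)))
      = (\<Sum>t=1..T. expectation (m t) + expectation (\<lambda>\<omega>. (1/2) * A t \<omega> + z t \<omega> * A t \<omega>))"
      by (intro sum.cong refl, rule Bochner_Integration.integral_add) (use int_m int_pA in auto)
  qed
  also have "\<dots> = (\<Sum>t=1..T. expectation (m t)) + (\<Sum>t=1..T. expectation (\<lambda>\<omega>. (1/2) * A t \<omega> + z T \<omega> * A t \<omega>))"
    unfolding sum.distrib by (intro arg_cong2[of _ _ _ _ "(+)"] sum.cong refl price)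
  also have "(\<Sum>t=1..T. expectation (\<lambda>\<omega>. (1/2) * A t \<omega> + z T \<omega> * A t \<omega>))
      = expectation (\<lambda>\<omega>. \<Sum>t=1..T. (1/2) * A t \<omega> + z T \<omega> * A t \<omega>)"
    using int_pA by (intro Bochner_Integration.integral_sum[symmetric]) auto
  \<comment> \<open>All hires are now charged at the same price, so only their number matters.\<close>
  also have "\<dots> \<le> expectation (\<lambda>\<omega>. real B * (1/2 + (z T \<omega> + 8 * z T \<omega> ^ 4)))"
  proof (rule integral_mono_AE)
    show "integrable P (\<lambda>\<omega>. \<Sum>t=1..T. (1/2) * A t \<omega> + z T \<omega> * A t \<omega>)"
      using int_pA by (intro Bochner_Integration.integrable_sum) auto
    show "integrable P (\<lambda>\<omega>. real B * (1/2 + (z T \<omega> + 8 * z T \<omega> ^ 4)))"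
      using integrable_z_power[of T 1] integrable_z_power[of T 4]
      by (intro integrable_mult_right Bochner_Integration.integrable_add) auto
    have "AE \<omega> in P. (\<Sum>t=1..T. a t \<omega>) \<le> B" using a by (simp add: policies_def)
    thus "AE \<omega> in P. (\<Sum>t=1..T. (1/2) * A t \<omega> + z T \<omega> * A t \<omega>) \<le> real B * (1/2 + (z T \<omega> + 8 * z T \<omega> ^ 4))"
    proof eventually_elim
      case (elim \<omega>)
      have "(\<Sum>t=1..T. A t \<omega>) = real (\<Sum>t=1..T. a t \<omega>)" by (simp add: A_def)
      hence budget: "(\<Sum>t=1..T. A t \<omega>) \<le> real B" "0 \<le> (\<Sum>t=1..T. A t \<omega>)" using elim
        by (simp_all only: of_nat_le_iff of_nat_0_le_iff)
      have "(\<Sum>t=1..T. (1/2) * A t \<omega> + z T \<omega> * A t \<omega>) = (1/2 + z T \<omega>) * (\<Sum>t=1..T. A t \<omega>)"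
        unfolding sum_distrib_left distrib_right ..
      also have "\<dots> \<le> max 0 (1/2 + z T \<omega>) * (\<Sum>t=1..T. A t \<omega>)" using budget by (intro mult_right_mono) auto
      also have "\<dots> \<le> (1/2 + z T \<omega> + 8 * z T \<omega> ^ 4) * real B"
        using budget pospart_le_quartic[of "z T \<omega>"] by (intro mult_mono) auto
      finally show ?case by (simp add: algebra_simps)
    qed
  qed
  also have "expectation (\<lambda>\<omega>. real B * (1/2 + (z T \<omega> + 8 * z T \<omega> ^ 4)))
      = real B * (1/2 + (expectation (z T) + 8 * expectation (\<lambda>\<omega>. z T \<omega> ^ 4)))"
    using integrable_z_power[of T 1] integrable_z_power[of T 4] by (simp add: prob_space)
  also have "\<dots> \<le> real B * (1/2 + 24 * (V T)\<^sup>2)"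
    using z_moments[of T] by (intro mult_left_mono) auto
  also have "(\<Sum>t=1..T. expectation (m t)) \<le> (\<Sum>t=1..T. 1/8 - k t / 4 + V (t - 1) + (k t)\<^sup>2 / 4)"
    by (intro sum_mono E_m)
  finally show ?thesis by simp
qed

lemma reverse_sum:
  fixes f :: "nat \<Rightarrow> real"
  assumes "t \<le> T"
  shows "(\<Sum>r=1..t. f (T - r + 1)) = (\<Sum>s\<in>{T - t<..T - t + t}. f s)"
  using assms by (intro sum.reindex_bij_witness[of _ "\<lambda>s. T - s + 1" "\<lambda>r. T - r + 1"]) auto

text \<open>
  The price at a time with \<open>s\<close> periods to go has variance of order \<open>1/s\<close>, comparable to the step size.
\<close>
lemma V_early:
  assumes "t \<le> T - h"
  shows "V t \<le> 1 / (16 * real (T - t))"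
proof -
  have tT: "t \<le> T" "1 \<le> T - t" using assms h by auto
  have "V t = (\<Sum>r=1..t. 1 / 16 * (1 / (real (T - r + 1))\<^sup>2))"
    unfolding V_def
  proof (intro sum.cong refl)
    fix r assume "r \<in> {1..t}"
    hence "k r = 1 / (2 * real (T - r + 1))" using assms by (simp add: k_def)
    moreover have "(1 / (2 * s))\<^sup>2 / 4 = 1 / 16 * (1 / s\<^sup>2)" for s :: real
      by (simp add: power_divide power_mult_distrib)
    ultimately show "(k r)\<^sup>2 / 4 = 1 / 16 * (1 / (real (T - r + 1))\<^sup>2)" by (simp only:)
  qed
  also have "\<dots> = 1 / 16 * (\<Sum>s\<in>{T - t<..T - t + t}. 1 / (real s)\<^sup>2)"
    unfolding sum_distrib_left[symmetric] using reverse_sum[OF tT(1), of "\<lambda>s. 1 / (real s)\<^sup>2"] by simp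
  also have "\<dots> \<le> 1 / 16 * (1 / real (T - t))"
    using sum_inverse_squares_le[OF tT(2), of t] by (intro mult_left_mono) (auto intro: order_trans)
  finally show ?thesis by simp
qed

lemma V_late: "V t \<le> 1 / (16 * real h)"
proof (cases "t \<le> T - h")
  case True
  have "V t \<le> 1 / (16 * real (T - t))" using True by (rule V_early)
  also have "\<dots> \<le> 1 / (16 * real h)" using True h by (intro frac_le) auto
  finally show ?thesis .
next
  case False
  have "V t = V (T - h)"
    unfolding V_def using False by (intro sum.mono_neutral_right) (auto simp: k_def)
  also have "\<dots> \<le> 1 / (16 * real (T - (T - h)))" by (rule V_early) simp
  finally show ?thesis using h by simp
qed

text \<open>
  With \<open>s\<close> periods to go the gain is \<open>1/(8s)\<close> and the cost of the accumulated variance at most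
  \<open>1/(16s)\<close>; what remains is the harmonic sum. The last \<open>h\<close> periods, in which the price is frozen, and the
  squared step sizes contribute only constants.
\<close>
lemma total_step_value_le:
  "(\<Sum>t=1..T. 1/8 - k t / 4 + V (t - 1) + (k t)\<^sup>2 / 4) \<le> real T / 8 - (ln (real T) - ln (real (h + 1))) / 16 + 1/8"
proof -
  have "(\<Sum>t=1..T. - k t / 4 + V (t - 1))
      \<le> (\<Sum>t=1..T. if t \<le> T - h then - 1/16 * (1 / real (T - t + 1)) else 1 / (16 * real h))"
  proof (rule sum_mono)
    fix t assume t: "t \<in> {1..T}"
    show "- k t / 4 + V (t - 1) \<le> (if t \<le> T - h then - 1/16 * (1 / real (T - t + 1)) else 1 / (16 * real h))"
    proof (cases "t \<le> T - h")
      case True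
      have "V (t - 1) \<le> 1 / (16 * real (T - (t - 1)))" using True by (intro V_early) auto
      also have "T - (t - 1) = T - t + 1" using t by auto
      finally have "V (t - 1) \<le> 1/16 * (1 / real (T - t + 1))" by simp
      moreover have "k t = 1/2 * (1 / real (T - t + 1))" using True by (simp add: k_def)
      ultimately show ?thesis unfolding if_P[OF True] by linarith
    next
      case False thus ?thesis using V_late[of "t - 1"] by (simp add: k_def)
    qed
  qed
  also have "\<dots> = (\<Sum>t\<in>{1..T - h}. - 1/16 * (1 / real (T - t + 1))) + (\<Sum>t\<in>{T - h<..T}. 1 / (16 * real h))"
  proof -
    have "{1..T} \<inter> {t. t \<le> T - h} = {1..T - h}" "{1..T} \<inter> - {t. t \<le> T - h} = {T - h<..T}" by auto
    thus ?thesis by (subst sum.If_cases) auto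
  qed
  also have "(\<Sum>t\<in>{T - h<..T}. 1 / (16 * real h)) = 1/16" using h by simp
  also have "(\<Sum>t\<in>{1..T - h}. - 1/16 * (1 / real (T - t + 1))) = - 1/16 * (\<Sum>s\<in>{h<..h + (T - h)}. 1 / real s)"
    unfolding sum_distrib_left[symmetric] using reverse_sum[of "T - h" "\<lambda>s. 1 / real s"] h by simp
  also have "\<dots> \<le> - 1/16 * (ln (real T) - ln (real (h + 1)))"
  proof -
    have "ln (real T) \<le> ln (1 + real T)" using h by simp
    hence "ln (real T) - ln (real (h + 1)) \<le> (\<Sum>s\<in>{h<..h + (T - h)}. 1 / real s)"
      using sum_inverse_ge_ln[of h "T - h"] le_add_diff_inverse[OF h(2)] by simp
    thus ?thesis by simp
  qed
  finally have "(\<Sum>t=1..T. - k t / 4 + V (t - 1)) \<le> - 1/16 * (ln (real T) - ln (real (h + 1))) + 1/16" by simp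
  moreover have "(\<Sum>t=1..T. 1/8 - k t / 4 + V (t - 1) + (k t)\<^sup>2 / 4)
      = real T / 8 + (\<Sum>t=1..T. - k t / 4 + V (t - 1)) + V T"
    unfolding V_def[of T] by (simp add: sum.distrib sum_subtractf sum_negf)
  moreover have "V T \<le> 1/16"
  proof -
    have "1 / (16 * real h) \<le> 1 / 16" using h by (intro frac_le) auto
    thus ?thesis using V_late[of T] by linarith
  qed
  ultimately show ?thesis by linarith
qed

text \<open>
  Both the hindsight value and the leading part of the upper bound for the policy are \<open>3T/8\<close> up to a
  constant, for even and odd \<open>T\<close>; the logarithm is what is left.
\<close>
lemma uniform_regret:
  assumes a: "a \<in> policies F (T div 2) T"
  shows "regret F (T div 2) T a \<ge> (ln (real T) - ln (real (h + 1))) / 16 - 5/16"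
proof -
  define b where "b = real (T div 2)"
  have b: "real T / 2 - 1/2 \<le> b" "b \<le> real T / 2" "0 \<le> b" unfolding b_def by linarith+
  have opt: "expectation (best (T div 2)) \<ge> b - b * (b + 1) / (2 * (real T + 1))"
    using expectation_best_ge[of "T div 2"] by (simp add: b_def add.commute)
  have alg: "expectation (\<lambda>\<omega>. \<Sum>t=1..T. ability t \<omega> * real (a t \<omega>))
      \<le> real T / 8 - (ln (real T) - ln (real (h + 1))) / 16 + 1/8 + (b / 2 + 24 * b * (V T)\<^sup>2)"
    using reward_le[OF a] total_step_value_le by (simp add: b_def algebra_simps)
  have "24 * b * (V T)\<^sup>2 \<le> 24 * (real T / 2) * (1 / (16 * real h))\<^sup>2"
  proof -
    have "0 \<le> V T" by (simp add: V_def sum_nonneg)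
    thus ?thesis using b V_late[of T] by (intro mult_mono power_mono) auto
  qed
  also have "\<dots> = 3/64 * (real T / (real h)\<^sup>2)" by (simp add: power_divide power_mult_distrib)
  also have "\<dots> \<le> 3/64 * 1"
  proof -
    have "real T \<le> (real h)\<^sup>2" using h(3) by (metis of_nat_le_iff of_nat_power)
    thus ?thesis using h(1) by (intro mult_left_mono) auto
  qed
  finally have V: "24 * b * (V T)\<^sup>2 \<le> 3/64" by simp
  \<comment> \<open>The left-over \<open>b (T - b) / (2 (T + 1))\<close> is smallest for odd \<open>T\<close>, where \<open>b = (T - 1) / 2\<close>.\<close>
  have "(real T - 1) / 8 \<le> b / 2 - b * (b + 1) / (2 * (real T + 1))"
  proof -
    have "0 \<le> (b - (real T / 2 - 1/2)) * ((real T / 2 + 1/2) - b)" using b by (intro mult_nonneg_nonneg) auto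
    hence "(real T - 1) * (real T + 1) / 4 \<le> b * (real T - b)" by (simp add: field_simps)
    hence "(real T - 1) * (real T + 1) / 4 / (2 * (real T + 1)) \<le> b * (real T - b) / (2 * (real T + 1))"
      by (intro divide_right_mono) auto
    moreover have "b / 2 - b * (b + 1) / (2 * (real T + 1)) = b * (real T - b) / (2 * (real T + 1))"
      by (simp add: field_simps)
    moreover have "(real T - 1) * (real T + 1) / 4 / (2 * (real T + 1)) = (real T - 1) / 8"
      by (simp add: field_simps)
    ultimately show ?thesis by linarith
  qed
  moreover have "regret F (T div 2) T a = expectation (best (T div 2)) - expectation (\<lambda>\<omega>. \<Sum>t=1..T. ability t \<omega> * real (a t \<omega>))"
    unfolding regret_eq[OF a] by (rule Bochner_Integration.integral_diff[OF integrable_best integrable_collected[OF a]])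
  ultimately show ?thesis using opt alg V by argo
qed

end

section \<open>The lower bound\<close>

lemma uniform_law_clustered: "quantile_law (\<lambda>q. q) \<in> clustered_class 0 (1/2)"
proof -
  interpret quantile_function "\<lambda>q::real. q" by unfold_locales (auto intro: monoI)
  show ?thesis by (rule quantile_law_clustered[of 0 1]) auto
qed

lemma clustered_class_ability_distribution:
  "F \<in> clustered_class \<beta> \<epsilon> \<Longrightarrow> ability_distribution F"
  by (simp add: clustered_class_def clustered_def)

lemma half_budget_le_Sup_regret:
  assumes "T \<ge> 2"
  shows "regret F (T div 2) T (\<pi> (T div 2)) \<le> (SUP B\<in>{1..T}. regret F B T (\<pi> B))"
  using assms by (intro cSUP_upper bdd_above_finite) auto

theorem theorem1:
  shows "\<exists>c::real. c > 0 \<and>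
    (\<forall>\<beta>::real. \<beta> \<ge> 0 \<longrightarrow>
      (\<exists>F \<in> clustered_class \<beta> (1/2). \<exists>T\<^sub>0::nat. \<forall>T::nat. T \<ge> T\<^sub>0 \<longrightarrow>
        (\<forall>\<pi> :: nat \<Rightarrow> nat \<Rightarrow> scenario \<Rightarrow> nat.
          (\<forall>B\<in>{1..T}. \<pi> B \<in> policies F B T) \<longrightarrow>
          (SUP B\<in>{1..T}. regret F B T (\<pi> B))
            \<ge> c / (1 + \<beta>) * real T powr (1/2 - 1 / (2 * (\<beta> + 1))) * of_bool (\<beta> > 0)
              + c * ln (real T) * of_bool (\<beta> = 0))))"
proof (rule exI[of _ "1 / 10^10"], intro conjI allI impI)
  fix \<beta> :: real assume \<beta>: "\<beta> \<ge> 0"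
  show "\<exists>F \<in> clustered_class \<beta> (1/2). \<exists>T\<^sub>0::nat. \<forall>T::nat. T \<ge> T\<^sub>0 \<longrightarrow>
        (\<forall>\<pi> :: nat \<Rightarrow> nat \<Rightarrow> scenario \<Rightarrow> nat.
          (\<forall>B\<in>{1..T}. \<pi> B \<in> policies F B T) \<longrightarrow>
          (SUP B\<in>{1..T}. regret F B T (\<pi> B))
            \<ge> 1 / 10^10 / (1 + \<beta>) * real T powr (1/2 - 1 / (2 * (\<beta> + 1))) * of_bool (\<beta> > 0)
              + 1 / 10^10 * ln (real T) * of_bool (\<beta> = 0))"
  proof (cases "\<beta> = 0")
    case False
    define \<alpha> where "\<alpha> = 1 / (\<beta> + 1)"
    have \<alpha>: "0 < \<alpha>" "\<alpha> \<le> 1" using \<beta> by (auto simp: \<alpha>_def)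
    let ?F = "quantile_law (hinge_quantile \<alpha>)"
    have F: "?F \<in> clustered_class \<beta> (1/2)" unfolding \<alpha>_def using \<beta> by (rule hinge_law_clustered)
    show ?thesis
    proof (intro bexI[OF _ F] exI[of _ 10000] allI impI)
      fix T :: nat and \<pi> :: "nat \<Rightarrow> nat \<Rightarrow> scenario \<Rightarrow> nat"
      assume T: "10000 \<le> T" and \<pi>: "\<forall>B\<in>{1..T}. \<pi> B \<in> policies ?F B T"
      interpret hinge_secretary ?F T \<alpha>
        using \<alpha> T clustered_class_ability_distribution[OF F] by unfold_locales auto
      have "1 / 10^10 * \<alpha> * T powr (1/2 - \<alpha> / 2) \<le> regret ?F (T div 2) T (\<pi> (T div 2))"
        using \<pi> T by (intro hinge_regret) auto
      also have "\<dots> \<le> (SUP B\<in>{1..T}. regret ?F B T (\<pi> B))"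
        using T by (intro half_budget_le_Sup_regret) auto
      also have "1/2 - \<alpha> / 2 = 1/2 - 1 / (2 * (\<beta> + 1))" using \<beta> by (simp add: \<alpha>_def)
      finally show "(SUP B\<in>{1..T}. regret ?F B T (\<pi> B))
            \<ge> 1 / 10^10 / (1 + \<beta>) * real T powr (1/2 - 1 / (2 * (\<beta> + 1))) * of_bool (\<beta> > 0)
              + 1 / 10^10 * ln (real T) * of_bool (\<beta> = 0)"
        using False \<beta> by (simp add: \<alpha>_def add.commute)
    qed
  next
    case True
    let ?F = "quantile_law (\<lambda>q. q)"
    have F: "?F \<in> clustered_class \<beta> (1/2)" unfolding True by (rule uniform_law_clustered)
    show ?thesis
    \<comment> \<open>The bound is \<open>ln T / 32 - 3/8\<close>; once \<open>ln T \<ge> 24\<close> the constant is at most half of the main term.\<close>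
    proof (intro bexI[OF _ F] exI[of _ "nat \<lceil>exp (24::real)\<rceil>"] allI impI)
      fix T :: nat and \<pi> :: "nat \<Rightarrow> nat \<Rightarrow> scenario \<Rightarrow> nat"
      assume "nat \<lceil>exp (24::real)\<rceil> \<le> T" and \<pi>: "\<forall>B\<in>{1..T}. \<pi> B \<in> policies ?F B T"
      hence exp: "exp 24 \<le> real T" by linarith
      moreover have "25 \<le> exp (24 :: real)" using exp_ge_add_one_self[of 24] by simp
      ultimately have T: "25 \<le> T" by linarith
      have lnT: "24 \<le> ln (real T)" using exp T by (subst ln_ge_iff) auto
      \<comment> \<open>The shortest final stretch that \<open>price_martingale\<close> allows.\<close>
      define h where "h = nat \<lceil>sqrt (real T)\<rceil>"
      have s: "5 \<le> sqrt (real T)" using T by (intro real_le_rsqrt) simp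
      have h_ge: "sqrt (real T) \<le> real h" and h_le: "real h < sqrt (real T) + 1"
        unfolding h_def using s by linarith+
      have "sqrt (real T) * 5 \<le> sqrt (real T) * sqrt (real T)" using s by (intro mult_left_mono) auto
      hence "real h \<le> real T" using h_le s by simp
      hence hT: "h \<le> T" by (simp only: of_nat_le_iff)
      have "(sqrt (real T))\<^sup>2 \<le> (real h)\<^sup>2" using h_ge s by (intro power_mono) auto
      hence "real T \<le> real (h\<^sup>2)" by simp
      hence Th: "T \<le> h\<^sup>2" by (simp only: of_nat_le_iff)
      have "1 \<le> h" using h_ge s by linarith
      then interpret price_martingale ?F T h
        using clustered_class_ability_distribution[OF F] hT Th by unfold_locales auto
      have "ln (real (h + 1)) \<le> ln (2 * sqrt (real T))"
        using h_le s T by (subst ln_le_cancel_iff) auto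
      also have "\<dots> = ln 2 + ln (real T) / 2" using T by (simp add: ln_mult ln_sqrt)
      finally have "ln (real (h + 1)) \<le> 1 + ln (real T) / 2" using ln_2_less_1 by linarith
      moreover have "x / 64 \<le> (x - y) / 16 - 5/16" if "y \<le> 1 + x / 2" "24 \<le> x" for x y :: real
        using that by (simp add: field_simps)
      ultimately have "ln (real T) / 64 \<le> (ln (real T) - ln (real (h + 1))) / 16 - 5/16" using lnT by blast
      also have "\<dots> \<le> regret ?F (T div 2) T (\<pi> (T div 2))"
        using \<pi> T by (intro uniform_regret) auto
      also have "\<dots> \<le> (SUP B\<in>{1..T}. regret ?F B T (\<pi> B))"
        using T by (intro half_budget_le_Sup_regret) auto
      finally have "ln (real T) / 64 \<le> (SUP B\<in>{1..T}. regret ?F B T (\<pi> B))" .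
      moreover have "1 / 10^10 * ln (real T) \<le> ln (real T) / 64" using lnT by simp
      ultimately show "(SUP B\<in>{1..T}. regret ?F B T (\<pi> B))
            \<ge> 1 / 10^10 / (1 + \<beta>) * real T powr (1/2 - 1 / (2 * (\<beta> + 1))) * of_bool (\<beta> > 0)
              + 1 / 10^10 * ln (real T) * of_bool (\<beta> = 0)"
        using True by simp
    qed
  qed
qed simp

end
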